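(* There exists a constant $K$ such that for every integer $n\ge1$, $$\operatorname{diam}_S\big(\mathrm{Tree}(n)\big)\le K\log(n),$$ where $\operatorname{diam}_S$ is the diameter in the metric $d_S$ of simultaneous Whitehead moves.
   Context: A binary tree is a finite tree in which each vertex has valence one or three. It is rooted if it has a distinguished exterior edge $e_*$ (an edge with a valence-1 endpoint). A labeled tree of complexity $n$ is a rooted binary tree with $n+2$ exterior edges in which the $n+1$ ends (the exterior edges other than $e_*$) are labeled bijectively by $0,1,\dots,n$; two labeled trees are equal if there is a homeomorphism between them taking root to root and preserving labels. $\mathrm{Tree}(n)$ is the finite set of labeled trees of complexity $n$. An edge is interior if both its endpoints have valence three. A Whitehead move on an interior edge $e$ collapses $e$ to a valence-4 vertex and reopens it in one of the two other ways of splitting the four incident edges into two pairs. Two edges are disjoint if they share no vertex. A simultaneous Whitehead move is a composition of Whitehead moves on any number of pairwise disjoint interior edges. $d_S(T,T')$ is the minimal number of simultaneous Whitehead moves transforming $T$ into $T'$. *)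

theory Defs
  imports Complex_Main "HOL-Library.Extended_Real"
begin

text \<open>
  A rooted, labeled, finite simple graph.  The topological trees of interest have no vertex of
  valence two, so homeomorphisms between them are the same, up to isotopy, as graph isomorphisms;
  hence it is enough to take natural numbers as vertices and to pass to isomorphism classes.

  In a binary tree with at least three exterior edges, every exterior edge has exactly one endpoint
  of valence one.  Exterior edges are represented by these endpoints: \<open>root\<close> is the leaf of the
  distinguished edge, and \<open>end_at i\<close> is the leaf of the end with label \<open>i\<close> (values at \<open>i > n\<close> are
  irrelevant for trees of complexity \<open>n\<close>).
\<close>

record ltree =
  verts :: "nat set"
  edges :: "nat set set"
  root :: nat
  end_at :: "nat \<Rightarrow> nat"

definition valence :: "ltree \<Rightarrow> nat \<Rightarrow> nat" where
  "valence T v = card {e \<in> edges T. v \<in> e}"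

definition neighbors :: "ltree \<Rightarrow> nat \<Rightarrow> nat set" where
  "neighbors T v = {w. {v, w} \<in> edges T}"

definition simple_graph :: "ltree \<Rightarrow> bool" where
  "simple_graph T \<longleftrightarrow> finite (verts T) \<and> (\<forall>e\<in>edges T. e \<subseteq> verts T \<and> card e = 2)"

definition connected_graph :: "ltree \<Rightarrow> bool" where
  "connected_graph T \<longleftrightarrow> (\<forall>u\<in>verts T. \<forall>v\<in>verts T. (u, v) \<in> {(x, y). {x, y} \<in> edges T}\<^sup>*)"

definition is_cycle :: "ltree \<Rightarrow> nat list \<Rightarrow> bool" where
  "is_cycle T p \<longleftrightarrow> 3 \<le> length p \<and> distinct p \<and>
     (\<forall>i<length p. {p ! i, p ! (Suc i mod length p)} \<in> edges T)"

definition binary_tree :: "ltree \<Rightarrow> bool" where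
  "binary_tree T \<longleftrightarrow> simple_graph T \<and> connected_graph T \<and> (\<nexists>p. is_cycle T p) \<and>
     (\<forall>v\<in>verts T. valence T v \<in> {1, 3})"

definition leaves :: "ltree \<Rightarrow> nat set" where
  "leaves T = {v \<in> verts T. valence T v = 1}"

definition interior_edges :: "ltree \<Rightarrow> nat set set" where
  "interior_edges T = {e \<in> edges T. \<forall>v\<in>e. valence T v = 3}"

definition labeled_tree :: "nat \<Rightarrow> ltree \<Rightarrow> bool" where
  "labeled_tree n T \<longleftrightarrow> binary_tree T \<and> root T \<in> leaves T \<and> card (leaves T) = n + 2 \<and>
     bij_betw (end_at T) {0..n} (leaves T - {root T})"

definition tree_iso :: "nat \<Rightarrow> (ltree \<times> ltree) set" where
  "tree_iso n = {(T, T'). labeled_tree n T \<and> labeled_tree n T' \<and>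
     (\<exists>f. bij_betw f (verts T) (verts T') \<and> (`) f ` edges T = edges T' \<and>
          f (root T) = root T' \<and> (\<forall>i\<le>n. f (end_at T i) = end_at T' i))}"

definition Tree :: "nat \<Rightarrow> ltree set set" where
  "Tree n = {T. labeled_tree n T} // tree_iso n"

text \<open>
  Collapsing the edge \<open>{u, v}\<close> leaves a vertex with the four neighbors
  \<open>(neighbors T u - {v}) \<union> (neighbors T v - {u})\<close>.  These (equivalently, the four edges leading to
  them) are split into two pairs \<open>P\<close> and \<open>Q\<close> different from the original ones, and the vertex is
  reopened to an edge, again called \<open>{u, v}\<close>, with \<open>P\<close> attached to \<open>u\<close> and \<open>Q\<close> attached to \<open>v\<close>.
  Edges that do not meet \<open>{u, v}\<close> thus remain literally the same.
\<close>

definition whitehead_move :: "ltree \<Rightarrow> nat set \<Rightarrow> ltree \<Rightarrow> bool" where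
  "whitehead_move T e T' \<longleftrightarrow> e \<in> interior_edges T \<and>
     (\<exists>u v P Q. e = {u, v} \<and> u \<noteq> v \<and>
        P \<union> Q = (neighbors T u - {v}) \<union> (neighbors T v - {u}) \<and> P \<inter> Q = {} \<and>
        card P = 2 \<and> card Q = 2 \<and>
        {P, Q} \<noteq> {neighbors T u - {v}, neighbors T v - {u}} \<and>
        T' = T\<lparr>edges := {d \<in> edges T. disjnt d e} \<union> {e} \<union> {{u, x} | x. x \<in> P} \<union> {{v, x} | x. x \<in> Q}\<rparr>)"

inductive whitehead_moves :: "ltree \<Rightarrow> nat set list \<Rightarrow> ltree \<Rightarrow> bool" where
  Nil: "whitehead_moves T [] T"
| Cons: "whitehead_move T e T' \<Longrightarrow> whitehead_moves T' es T'' \<Longrightarrow> whitehead_moves T (e # es) T''"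

definition simultaneous_move :: "ltree \<Rightarrow> ltree \<Rightarrow> bool" where
  "simultaneous_move T T' \<longleftrightarrow>
     (\<exists>es. set es \<subseteq> interior_edges T \<and> sorted_wrt disjnt es \<and> whitehead_moves T es T')"

definition simultaneous_step :: "nat \<Rightarrow> (ltree set \<times> ltree set) set" where
  "simultaneous_step n =
     {(X, Y) \<in> Tree n \<times> Tree n. \<exists>T\<in>X. \<exists>T'\<in>Y. simultaneous_move T T'}"

text \<open>The value is \<open>\<infinity>\<close> if no sequence of moves leads from \<open>X\<close> to \<open>Y\<close>.\<close>

definition d_S :: "nat \<Rightarrow> ltree set \<Rightarrow> ltree set \<Rightarrow> enat" where
  "d_S n X Y = (INF k \<in> {k. (X, Y) \<in> simultaneous_step n ^^ k}. enat k)"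

definition diam_S :: "nat \<Rightarrow> enat" where
  "diam_S n = (SUP X \<in> Tree n. SUP Y \<in> Tree n. d_S n X Y)"

end

theory Submission
  imports Defs "HOL-Library.Multiset"
begin

text \<open>
  View a rooted labeled tree as a term with binary nodes, up to exchanging the two subterms of a
  node.  A simultaneous move rotates a set of vertex-disjoint interior edges of such a term.

  First, every term with \<open>N\<close> leaves gets logarithmic height in \<open>O(log N)\<close> rounds.  Regard a term as a
  skeleton whose leaves are blocks (subterms).  In a bounded number of rounds, neighboring blocks on
  a caterpillar stretch \<open>Nd a (Nd b x)\<close> are joined to one block; together with sibling blocks
  \<open>Nd a b\<close> this removes a quarter of the blocks and raises their heights by one.

  Second, a term of height \<open>h\<close> becomes the binary trie of its labels in \<open>O(h + log N)\<close> rounds by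
  merging tries at all nodes.  To merge two tries, \<open>Nd (Nd a b) (Nd c d)\<close> is turned into
  \<open>Nd (Nd a c) (Nd b d)\<close>, after which the two pairs are merged independently.  A merge thus delivers
  its top level after a bounded number of rounds and one further level per bounded number of rounds
  after that, so the merge at the parent node need not wait for it to finish: the merges are
  pipelined, as in Cole's parallel merge sort.

  Both moves are reversible, so any two labeled trees are connected through the trie.
\<close>

section \<open>Terms and simultaneous rotations\<close>

datatype 'a tm = Lf 'a | Nd "'a tm" "'a tm"

text \<open>
  Only the last rule moves an edge, namely the one between the two displayed nodes.  As its
  recursive premises concern the subterms below both of them, the edges moved in one \<open>par\<close> step are
  automatically vertex-disjoint.
\<close>

inductive par :: "'a tm \<Rightarrow> 'a tm \<Rightarrow> bool" where
  par_leaf: "par (Lf a) (Lf a)"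
| par_cong: "par a a' \<Longrightarrow> par b b' \<Longrightarrow> par (Nd a b) (Nd a' b')"
| par_swap: "par a a' \<Longrightarrow> par b b' \<Longrightarrow> par (Nd a b) (Nd b' a')"
| par_rot: "par a a' \<Longrightarrow> par b b' \<Longrightarrow> par c c' \<Longrightarrow> par (Nd (Nd a b) c) (Nd (Nd a' c') b')"

lemma par_refl [simp]: "par t t"
  by (induction t) (auto intro: par.intros)

lemma par_sym: "par s t \<Longrightarrow> par t s"
  by (induction rule: par.induct) (auto intro: par.intros)

text \<open>A round may move nothing, so \<open>k\<close> rounds always stand for at most
  \<open>k\<close> rounds.\<close>

lemma steps_refl [simp]: "(par ^^ k) t t"
  by (induction k) (auto intro: relpowp_Suc_I)

lemma steps_add: "(par ^^ j) s t \<Longrightarrow> (par ^^ k) t u \<Longrightarrow> (par ^^ (j + k)) s u"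
  by (auto simp: relpowp_add)

lemma steps_split: "(par ^^ (j + k)) s u \<Longrightarrow> \<exists>t. (par ^^ j) s t \<and> (par ^^ k) t u"
  by (auto simp: relpowp_add)

lemma steps_mono: "(par ^^ j) s t \<Longrightarrow> j \<le> k \<Longrightarrow> (par ^^ k) s t"
  using steps_add[of j s t "k - j" t] by simp

lemma par_steps:
  assumes "par s t" "0 < k"
  shows "(par ^^ k) s t"
proof -
  have "(par ^^ 1) s t" unfolding relpowp_1 by (rule assms)
  then show ?thesis using assms(2) by (intro steps_mono[of 1 s t k]) auto
qed

lemma steps_sym: "(par ^^ k) s t \<Longrightarrow> (par ^^ k) t s"
proof (induction k arbitrary: t)
  case (Suc k)
  then obtain u where "(par ^^ k) s u" "par u t" by auto
  then show ?case using Suc.IH par_sym by (metis relpowp_Suc_I2)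
qed auto

lemma steps_cong: "(par ^^ k) a a' \<Longrightarrow> (par ^^ k) b b' \<Longrightarrow> (par ^^ k) (Nd a b) (Nd a' b')"
proof (induction k arbitrary: a' b')
  case (Suc k)
  from Suc.prems obtain u v where "(par ^^ k) a u" "par u a'" "(par ^^ k) b v" "par v b'"
    by auto
  then show ?case using Suc.IH by (auto intro!: relcomppI par_cong)
qed auto

section \<open>Leaf multisets and substitution for leaves\<close>

primrec leaf_list :: "'a tm \<Rightarrow> 'a list" where
  "leaf_list (Lf a) = [a]"
| "leaf_list (Nd s t) = leaf_list s @ leaf_list t"

lemma set_leaf_list [simp]: "set (leaf_list t) = set_tm t"
  by (induction t) auto

lemma par_leaf_list: "par s t \<Longrightarrow> mset (leaf_list s) = mset (leaf_list t)"
  by (induction rule: par.induct) auto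

lemma steps_leaf_list: "(par ^^ k) s t \<Longrightarrow> mset (leaf_list s) = mset (leaf_list t)"
  by (induction k arbitrary: t) (auto dest: par_leaf_list)

primrec subst :: "('a \<Rightarrow> 'b tm) \<Rightarrow> 'a tm \<Rightarrow> 'b tm" where
  "subst \<sigma> (Lf a) = \<sigma> a"
| "subst \<sigma> (Nd s t) = Nd (subst \<sigma> s) (subst \<sigma> t)"

lemma par_subst: "par s t \<Longrightarrow> (\<And>x. par (\<sigma> x) (\<tau> x)) \<Longrightarrow> par (subst \<sigma> s) (subst \<tau> t)"
  by (induction rule: par.induct) (auto intro: par.intros)

text \<open>Rotations of the skeleton and rotations inside the substituted blocks involve different
  nodes, so both sequences share the same \<open>k\<close> rounds.\<close>

lemma steps_subst:
  "(par ^^ k) s t \<Longrightarrow> (\<And>x. (par ^^ k) (\<sigma> x) (\<tau> x)) \<Longrightarrow> (par ^^ k) (subst \<sigma> s) (subst \<tau> t)"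
proof (induction k arbitrary: t \<tau>)
  case 0
  then have "\<sigma> = \<tau>" "s = t" by auto
  then show ?case by simp
next
  case (Suc k)
  from Suc.prems(1) obtain u where u: "(par ^^ k) s u" "par u t" by auto
  \<comment> \<open>All blocks are stopped one round before their end, so that their last round
    coincides with the last round of the skeleton.\<close>
  have "\<forall>x. \<exists>z. (par ^^ k) (\<sigma> x) z \<and> par z (\<tau> x)" using Suc.prems(2) by auto
  then obtain \<rho> where \<rho>: "\<And>x. (par ^^ k) (\<sigma> x) (\<rho> x)" "\<And>x. par (\<rho> x) (\<tau> x)" by metis
  have "(par ^^ k) (subst \<sigma> s) (subst \<rho> u)" using Suc.IH u \<rho> by blast
  then show ?case using par_subst[OF u(2) \<rho>(2)] by auto
qed

section \<open>Local rearrangements within eight rounds\<close>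

lemma par_assoc_aux: "(par ^^ 3) (Nd (Nd a b) c) (Nd a (Nd b c))"
proof -
  \<comment> \<open>A swap does not change the unordered tree but takes up a round here, which
    affects only the constant.\<close>
  have "par (Nd (Nd a b) c) (Nd (Nd b a) c)" by (simp add: par_cong par_swap)
  moreover have "par (Nd (Nd b a) c) (Nd (Nd b c) a)" by (simp add: par_rot)
  moreover have "par (Nd (Nd b c) a) (Nd a (Nd b c))" by (simp add: par_swap)
  ultimately show ?thesis by (auto simp: numeral_3_eq_3)
qed

lemma interchange_aux:
  "(par ^^ 8) (Nd (Nd a b) (Nd c d)) (Nd (Nd a c) (Nd b d))"
proof -
  have "par (Nd (Nd a b) (Nd c d)) (Nd (Nd a (Nd c d)) b)" by (simp add: par_rot)
  moreover have "par (Nd (Nd a (Nd c d)) b) (Nd (Nd (Nd c d) a) b)" by (simp add: par_cong par_swap)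
  moreover have "par (Nd (Nd (Nd c d) a) b) (Nd (Nd (Nd c a) d) b)" by (simp add: par_cong par_rot)
  ultimately have 1: "(par ^^ 3) (Nd (Nd a b) (Nd c d)) (Nd (Nd (Nd c a) d) b)"
    by (auto simp: numeral_3_eq_3)
  have "(par ^^ 3) (Nd (Nd (Nd c a) d) b) (Nd (Nd c a) (Nd d b))" by (rule par_assoc_aux)
  from steps_add[OF 1 this] have 2: "(par ^^ 6) (Nd (Nd a b) (Nd c d)) (Nd (Nd c a) (Nd d b))" by simp
  have "par (Nd (Nd c a) (Nd d b)) (Nd (Nd a c) (Nd b d))" by (simp add: par_cong par_swap)
  then have "(par ^^ 1) (Nd (Nd c a) (Nd d b)) (Nd (Nd a c) (Nd b d))" by (rule par_steps) auto
  \<comment> \<open>These are 3 + 3 + 1 = 7 rounds; an idle one pads them to 8, the common budget of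
    all local rearrangements.\<close>
  from steps_add[OF 2 this] show ?thesis by (rule steps_mono) simp
qed

text \<open>Every index from 3 on is sent to \<open>d\<close>, so the premise of
  \<open>steps_subst\<close> about all leaves reduces to four cases.\<close>

definition assign :: "'a \<Rightarrow> 'a \<Rightarrow> 'a \<Rightarrow> 'a \<Rightarrow> nat \<Rightarrow> 'a" where
  "assign a b c d i = (if i = 0 then a else if i = 1 then b else if i = 2 then c else d)"

lemma steps_assign:
  assumes "(par ^^ 8) s t"
    "(par ^^ 8) a a'" "(par ^^ 8) b b'" "(par ^^ 8) c c'" "(par ^^ 8) d d'"
  shows "(par ^^ 8) (subst (assign a b c d) s) (subst (assign a' b' c' d') t)"
  using assms by (intro steps_subst) (auto simp: assign_def)

text \<open>The pattern is rearranged on four variables and the blocks are substituted afterwards;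
  thus the blocks advance by eight rounds of their own during the rearrangement. The variants below
  follow the same scheme.\<close>

lemma steps_interchange:
  assumes "(par ^^ 8) a a'" "(par ^^ 8) b b'" "(par ^^ 8) c c'" "(par ^^ 8) d d'"
  shows "(par ^^ 8) (Nd (Nd a b) (Nd c d)) (Nd (Nd a' c') (Nd b' d'))"
  using steps_assign[OF interchange_aux[of "Lf 0" "Lf 1" "Lf 2" "Lf 3"] assms]
  by (simp add: assign_def)

lemma steps_assoc:
  assumes "(par ^^ 8) a a'" "(par ^^ 8) b b'" "(par ^^ 8) c c'"
  shows "(par ^^ 8) (Nd (Nd a b) c) (Nd a' (Nd b' c'))"
  using steps_assign[OF steps_mono[OF par_assoc_aux[of "Lf 0" "Lf 1" "Lf 2"], of 8] assms steps_refl]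
  by (simp add: assign_def)

lemma steps_rot:
  assumes "(par ^^ 8) a a'" "(par ^^ 8) b b'" "(par ^^ 8) c c'"
  shows "(par ^^ 8) (Nd (Nd a b) c) (Nd (Nd a' c') b')"
proof -
  have "(par ^^ 8) (Nd (Nd (Lf 0) (Lf 1)) (Lf 2)) (Nd (Nd (Lf 0) (Lf 2)) (Lf (1::nat)))"
    by (intro par_steps par_rot) auto
  from steps_assign[OF this assms steps_refl]
  show ?thesis by (simp add: assign_def)
qed

lemma steps_swap:
  assumes "(par ^^ 8) a a'" "(par ^^ 8) b b'"
  shows "(par ^^ 8) (Nd a b) (Nd b' a')"
proof -
  have "(par ^^ 8) (Nd (Lf 0) (Lf 1)) (Nd (Lf 1) (Lf (0::nat)))"
    by (intro par_steps par_swap) auto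
  from steps_assign[OF this assms steps_refl steps_refl]
  show ?thesis by (simp add: assign_def)
qed

lemma steps_unassoc:
  assumes "(par ^^ 8) a a'" "(par ^^ 8) b b'" "(par ^^ 8) c c'"
  shows "(par ^^ 8) (Nd c (Nd a b)) (Nd (Nd c' a') b')"
  using steps_sym[OF steps_assoc[OF steps_sym[OF assms(3)] steps_sym[OF assms(1)] steps_sym[OF assms(2)]]] .

lemma left_commute_aux: "(par ^^ 3) (Nd c (Nd a b)) (Nd a (Nd c b))"
proof -
  have "par (Nd c (Nd a b)) (Nd (Nd b a) c)" by (simp add: par_swap)
  moreover have "par (Nd (Nd b a) c) (Nd (Nd b c) a)" by (simp add: par_rot)
  moreover have "par (Nd (Nd b c) a) (Nd a (Nd c b))" by (simp add: par_swap)
  ultimately show ?thesis by (auto simp: numeral_3_eq_3)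
qed

lemma steps_left_commute:
  assumes "(par ^^ 8) a a'" "(par ^^ 8) b b'" "(par ^^ 8) c c'"
  shows "(par ^^ 8) (Nd c (Nd a b)) (Nd a' (Nd c' b'))"
  using steps_assign[OF steps_mono[OF left_commute_aux[of "Lf 2" "Lf 0" "Lf 1"], of 8] assms steps_refl]
  by (simp add: assign_def)

section \<open>Pipelined merging of tries\<close>

text \<open>
  \<open>pipe q m k A t\<close>: in \<open>k\<close> rounds, \<open>t\<close> exhibits the top level of the trie of the label set \<open>A\<close> on the
  bits \<open>q i\<close>, \<open>i < m\<close>, and from then on each further level takes 8 more rounds.  Tries are
  compressed: there is no node at a bit on which all labels agree.
\<close>

primrec pipe :: "(nat \<Rightarrow> 'a \<Rightarrow> bool) \<Rightarrow> nat \<Rightarrow> nat \<Rightarrow> 'a set \<Rightarrow> 'a tm \<Rightarrow> bool" where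
  "pipe q 0 k A t \<longleftrightarrow> (\<exists>a. A = {a} \<and> (par ^^ k) t (Lf a))"
| "pipe q (Suc m) k A t \<longleftrightarrow> (\<exists>u. (par ^^ k) t u \<and>
     (if {a\<in>A. q m a} = {} then pipe q m 8 {a\<in>A. \<not> q m a} u
      else if {a\<in>A. \<not> q m a} = {} then pipe q m 8 {a\<in>A. q m a} u
      else \<exists>v w. u = Nd v w \<and> pipe q m 8 {a\<in>A. q m a} v \<and> pipe q m 8 {a\<in>A. \<not> q m a} w))"

text \<open>The canonical meeting point: it depends on the label set alone. For terms in a pipeline,
  \<open>pipe\<close> at 0 bits supplies the singleton that \<open>the_elem\<close> expects.\<close>

primrec trie :: "(nat \<Rightarrow> 'a \<Rightarrow> bool) \<Rightarrow> nat \<Rightarrow> 'a set \<Rightarrow> 'a tm" where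
  "trie q 0 A = Lf (the_elem A)"
| "trie q (Suc m) A =
     (if {a\<in>A. q m a} = {} then trie q m {a\<in>A. \<not> q m a}
      else if {a\<in>A. \<not> q m a} = {} then trie q m {a\<in>A. q m a}
      else Nd (trie q m {a\<in>A. q m a}) (trie q m {a\<in>A. \<not> q m a}))"

text \<open>This is the state that \<open>pipe\<close> at \<open>Suc m\<close> demands after its
  first \<open>k\<close> rounds, split off so that proofs need not unfold the recursion.\<close>

definition ready :: "(nat \<Rightarrow> 'a \<Rightarrow> bool) \<Rightarrow> nat \<Rightarrow> 'a set \<Rightarrow> 'a tm \<Rightarrow> bool" where
  "ready q m A u \<longleftrightarrow>
     (if {a\<in>A. q m a} = {} then pipe q m 8 {a\<in>A. \<not> q m a} u
      else if {a\<in>A. \<not> q m a} = {} then pipe q m 8 {a\<in>A. q m a} u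
      else \<exists>v w. u = Nd v w \<and> pipe q m 8 {a\<in>A. q m a} v \<and> pipe q m 8 {a\<in>A. \<not> q m a} w)"

lemma pipe_Suc: "pipe q (Suc m) k A t \<longleftrightarrow> (\<exists>u. (par ^^ k) t u \<and> ready q m A u)"
  by (simp only: pipe.simps ready_def)

declare pipe.simps(2) [simp del]

text \<open>The first \<open>j\<close> rounds of a delay can be run by themselves. This lets a
  subtrie progress while the level above it is being rearranged.\<close>

lemma pipe_advance:
  assumes "pipe q m (j + k) A t"
  shows "\<exists>u. (par ^^ j) t u \<and> pipe q m k A u"
proof (cases m)
  case 0
  then show ?thesis using assms steps_split by fastforce
next
  case (Suc l)
  then show ?thesis using assms steps_split unfolding Suc pipe_Suc by blast
qed

lemma pipe_delay:
  assumes "(par ^^ j) t u" "pipe q m k A u"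
  shows "pipe q m (j + k) A t"
proof (cases m)
  case 0
  then show ?thesis using assms steps_add by fastforce
next
  case (Suc l)
  then show ?thesis using assms steps_add unfolding Suc pipe_Suc by blast
qed

lemma pipe_mono: "pipe q m j A t \<Longrightarrow> j \<le> k \<Longrightarrow> pipe q m k A t"
  using pipe_delay[of "k - j" t t q m j A] by simp

lemma pipe_8_advance: "pipe q m 8 A t \<Longrightarrow> \<exists>u. (par ^^ 8) t u \<and> pipe q m 0 A u"
  using pipe_advance[of q m 8 0 A t] by simp

text \<open>After the initial delay \<open>k\<close>, each of the \<open>m\<close> levels costs 8,
  since the two subtries of a node run concurrently.\<close>

lemma pipe_trie: "pipe q m k A t \<Longrightarrow> (par ^^ (k + 8 * m)) t (trie q m A)"
proof (induction m arbitrary: k A t)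
  case 0
  then show ?case by auto
next
  case (Suc m)
  from Suc.prems obtain u where u: "(par ^^ k) t u" and *: "ready q m A u"
    unfolding pipe_Suc by blast
  have "(par ^^ (8 + 8 * m)) u (trie q (Suc m) A)"
  proof (cases "{a\<in>A. q m a} = {} \<or> {a\<in>A. \<not> q m a} = {}")
    case True
    then show ?thesis using * Suc.IH by (auto simp: ready_def split: if_splits)
  next
    case False
    then have eq: "trie q (Suc m) A = Nd (trie q m {a\<in>A. q m a}) (trie q m {a\<in>A. \<not> q m a})"
      by simp
    obtain v w where "u = Nd v w" "pipe q m 8 {a\<in>A. q m a} v" "pipe q m 8 {a\<in>A. \<not> q m a} w"
      using * False unfolding ready_def by metis
    then show ?thesis unfolding eq using steps_cong Suc.IH by blast
  qed
  from steps_add[OF u this] show ?case by (simp add: add.assoc)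
qed

lemma pipe_nonempty: "pipe q m k A t \<Longrightarrow> A \<noteq> {}"
proof (induction m arbitrary: k A t)
  case (Suc m)
  then obtain u where "ready q m A u" unfolding pipe_Suc by blast
  then show ?case using Suc.IH unfolding ready_def by (auto split: if_splits)
qed auto

text \<open>By compression, a single leaf is its own trie for any number of bits and needs no
  rounds.\<close>

lemma pipe_leaf: "pipe q m k {a} (Lf a)"
proof (induction m arbitrary: k)
  case (Suc m)
  have "{x \<in> {a}. q m x} = (if q m a then {a} else {})" "{x \<in> {a}. \<not> q m x} = (if q m a then {} else {a})"
    by auto
  then have "ready q m {a} (Lf a)" using Suc.IH by (simp add: ready_def)
  then show ?case unfolding pipe_Suc using steps_refl by blast
qed simp

section \<open>Merging tries of disjoint label sets\<close>

definition separated :: "(nat \<Rightarrow> 'a \<Rightarrow> bool) \<Rightarrow> nat \<Rightarrow> 'a set \<Rightarrow> bool" where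
  "separated q m A \<longleftrightarrow> (\<forall>a\<in>A. \<forall>b\<in>A. (\<forall>i<m. q i a = q i b) \<longrightarrow> a = b)"

lemma separated_bit:
  assumes "separated q (Suc m) A"
  shows "separated q m {a\<in>A. q m a = v}"
  unfolding separated_def
proof (intro ballI impI)
  fix a b assume "a \<in> {a\<in>A. q m a = v}" "b \<in> {a\<in>A. q m a = v}" "\<forall>i<m. q i a = q i b"
  then have "a \<in> A" "b \<in> A" "\<forall>i<Suc m. q i a = q i b" by (auto simp: less_Suc_eq)
  with assms show "a = b" unfolding separated_def by blast
qed

text \<open>The cases record which halves of \<open>A\<close> are inhabited;
  \<open>pipe_nonempty\<close> excludes that none is. In each case the subtries have used up their
  delay 8, leaving 0.\<close>

lemma ready_cases:
  assumes "ready q m A x" "A1 = {a\<in>A. q m a}" "A0 = {a\<in>A. \<not> q m a}"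
  obtains
      (low) v where "A1 = {}" "(par ^^ 8) x v" "pipe q m 0 A0 v" "A0 \<noteq> {}"
    | (high) v where "A0 = {}" "(par ^^ 8) x v" "pipe q m 0 A1 v" "A1 \<noteq> {}"
    | (both) v w v' w' where "A1 \<noteq> {}" "A0 \<noteq> {}" "x = Nd v w" "(par ^^ 8) v v'" "(par ^^ 8) w w'"
        "pipe q m 0 A1 v'" "pipe q m 0 A0 w'"
proof (cases "A1 = {}")
  case True
  then have *: "pipe q m 8 A0 x" using assms by (simp add: ready_def)
  show thesis using low[OF True _ _ pipe_nonempty[OF *]] pipe_8_advance[OF *] by blast
next
  case A1: False
  show thesis
  proof (cases "A0 = {}")
    case True
    then have "pipe q m 8 A1 x" using A1 assms unfolding ready_def by simp
    from pipe_8_advance[OF this] show thesis using high[OF True _ _ A1] by blast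
  next
    case False
    then obtain v w where "x = Nd v w" "pipe q m 8 A1 v" "pipe q m 8 A0 w"
      using assms(1) A1 unfolding ready_def assms(2,3)[symmetric] by auto
    then show thesis using both[OF A1 False] pipe_8_advance by metis
  qed
qed

text \<open>
  During the 8 rounds of rearranging the top level, the four subtries also run for 8 rounds and thus
  reach delay 0 instead of 8; this is what makes the merges of the next level as fast as this one.
\<close>

lemma ready_merge:
  assumes IH: "\<And>A B x y. \<lbrakk>pipe q m 0 A x; pipe q m 0 B y; A \<inter> B = {}; separated q m (A \<union> B)\<rbrakk>
      \<Longrightarrow> pipe q m 8 (A \<union> B) (Nd x y)"
    and x: "ready q m A x" and y: "ready q m B y"
    and disj: "A \<inter> B = {}" and sep: "separated q (Suc m) (A \<union> B)"
  shows "\<exists>z. (par ^^ 8) (Nd x y) z \<and> ready q m (A \<union> B) z"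
proof -
  define A1 A0 B1 B0 where defs: "A1 = {a\<in>A. q m a}" "A0 = {a\<in>A. \<not> q m a}"
    "B1 = {a\<in>B. q m a}" "B0 = {a\<in>B. \<not> q m a}"
  have un: "{a\<in>A \<union> B. q m a} = A1 \<union> B1" "{a\<in>A \<union> B. \<not> q m a} = A0 \<union> B0"
    by (auto simp: defs)
  have disj': "A1 \<inter> B1 = {}" "A0 \<inter> B0 = {}" using disj by (auto simp: defs)
  have sep': "separated q m (A1 \<union> B1)" "separated q m (A0 \<union> B0)"
    using separated_bit[OF sep, of True] separated_bit[OF sep, of False] unfolding un[symmetric]
    by (simp_all only: simp_thms)
  note IH1 = IH[OF _ _ disj'(1) sep'(1)] and IH0 = IH[OF _ _ disj'(2) sep'(2)]
  \<comment> \<open>A half that occurs in only one of the two tries has nothing to merge with; it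
    arrives with delay 0 and may wait.\<close>
  have up: "pipe q m 0 C z \<Longrightarrow> pipe q m 8 C z" for C z by (erule pipe_mono) simp
  have ready: "ready q m (A \<union> B) z \<longleftrightarrow>
     (if A1 \<union> B1 = {} then pipe q m 8 (A0 \<union> B0) z
      else if A0 \<union> B0 = {} then pipe q m 8 (A1 \<union> B1) z
      else \<exists>v w. z = Nd v w \<and> pipe q m 8 (A1 \<union> B1) v \<and> pipe q m 8 (A0 \<union> B0) w)" for z
    unfolding ready_def un ..
  show ?thesis
  \<comment> \<open>In each of the nine cases the witness puts the halves with the same bit next to
    each other: \<open>IH1\<close> and \<open>IH0\<close> merge halves present on both sides, and
    \<open>up\<close> handles the others.\<close>
  proof (cases rule: ready_cases[OF x defs(1,2), case_names low high both])
    case x: (low v)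
    show ?thesis
    proof (cases rule: ready_cases[OF y defs(3,4), case_names low high both])
      case y: (low r)
      show ?thesis using x y IH0[of v r] by (intro exI[of _ "Nd v r"]) (simp add: ready steps_cong)
    next
      case y: (high r)
      show ?thesis using x y by (intro exI[of _ "Nd r v"]) (simp add: ready steps_swap up)
    next
      case y: (both r s r' s')
      show ?thesis using x y IH0[of v s']
        by (intro exI[of _ "Nd r' (Nd v s')"]) (simp add: ready steps_left_commute up)
    qed
  next
    case x: (high v)
    show ?thesis
    proof (cases rule: ready_cases[OF y defs(3,4), case_names low high both])
      case y: (low r)
      show ?thesis using x y by (intro exI[of _ "Nd v r"]) (simp add: ready steps_cong up)
    next
      case y: (high r)
      show ?thesis using x y IH1[of v r] by (intro exI[of _ "Nd v r"]) (simp add: ready steps_cong)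
    next
      case y: (both r s r' s')
      show ?thesis using x y IH1[of v r']
        by (intro exI[of _ "Nd (Nd v r') s'"]) (simp add: ready steps_unassoc up)
    qed
  next
    case x: (both v w v' w')
    show ?thesis
    proof (cases rule: ready_cases[OF y defs(3,4), case_names low high both])
      case y: (low r)
      show ?thesis using x y IH0[of w' r]
        by (intro exI[of _ "Nd v' (Nd w' r)"]) (simp add: ready steps_assoc up)
    next
      case y: (high r)
      show ?thesis using x y IH1[of v' r]
        by (intro exI[of _ "Nd (Nd v' r) w'"]) (simp add: ready steps_rot up)
    next
      case y: (both r s r' s')
      show ?thesis using x y IH1[of v' r'] IH0[of w' s']
        by (intro exI[of _ "Nd (Nd v' r') (Nd w' s')"]) (simp add: ready steps_interchange)
    qed
  qed
qed

text \<open>A merge adds 8 to the delay whatever the depth of the tries, because the lower levels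
  follow in the pipeline.\<close>

lemma pipe_merge:
  "\<lbrakk>pipe q m k A x; pipe q m k B y; A \<inter> B = {}; separated q m (A \<union> B)\<rbrakk>
    \<Longrightarrow> pipe q m (k + 8) (A \<union> B) (Nd x y)"
proof (induction m arbitrary: k A B x y)
  case 0
  \<comment> \<open>With no bits left, separation forces the two singletons to be equal,
    contradicting disjointness.\<close>
  then show ?case by (auto simp: separated_def)
next
  case (Suc m)
  obtain u v where uv: "(par ^^ k) x u" "ready q m A u" "(par ^^ k) y v" "ready q m B v"
    using Suc.prems(1,2) unfolding pipe_Suc by blast
  obtain z where "(par ^^ 8) (Nd u v) z" "ready q m (A \<union> B) z"
    \<comment> \<open>\<open>ready_merge\<close> asks for the induction hypothesis at delay 0, where
      \<open>k + 8\<close> reads 8.\<close>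
    using ready_merge[OF _ uv(2,4) Suc.prems(3,4)] Suc.IH[of 0] by (metis add_0)
  then show ?case unfolding pipe_Suc using steps_add[OF steps_cong[OF uv(1,3)]] by blast
qed

primrec height :: "'a tm \<Rightarrow> nat" where
  "height (Lf a) = 0"
| "height (Nd s t) = Suc (max (height s) (height t))"

text \<open>Both children run in parallel, so a node adds 8 to the larger of their delays. Delays
  therefore grow with the height only, and the \<open>m\<close> levels are paid once at the
  end.\<close>

lemma pipe_height:
  "\<lbrakk>distinct (leaf_list t); separated q m (set_tm t)\<rbrakk> \<Longrightarrow> pipe q m (8 * height t) (set_tm t) t"
proof (induction t)
  case (Lf a)
  then show ?case by (simp add: pipe_leaf)
next
  case (Nd s t)
  let ?h = "8 * max (height s) (height t)"
  have "separated q m (set_tm s)" "separated q m (set_tm t)"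
    using Nd.prems(2) by (auto simp: separated_def)
  then have "pipe q m ?h (set_tm s) s" "pipe q m ?h (set_tm t) t"
    using Nd by (auto intro: pipe_mono)
  from pipe_merge[OF this] show ?case using Nd.prems by (simp add: add.commute)
qed

lemma steps_trie:
  assumes "distinct (leaf_list t)" "separated q m (set_tm t)"
  shows "(par ^^ (8 * height t + 8 * m)) t (trie q m (set_tm t))"
  using pipe_trie[OF pipe_height[OF assms]] .

section \<open>Balancing\<close>

text \<open>The outer term is the skeleton and its leaves are the blocks. Only leaves in left
  position are paired along a caterpillar; \<open>lefty\<close> arranges this beforehand.\<close>

fun rake :: "'a tm tm \<Rightarrow> 'a tm tm" where
  "rake (Lf b) = Lf b"
| "rake (Nd (Lf a) (Lf b)) = Lf (Nd a b)"
| "rake (Nd (Lf a) (Nd (Lf b) y)) = Nd (Lf (Nd a b)) (rake y)"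
| "rake (Nd x y) = Nd (rake x) (rake y)"

text \<open>Siblings join without any move, and a caterpillar pair joins by one reassociation. The
  pairs are disjoint, so all reassociations share the same eight rounds.\<close>

lemma steps_rake: "(par ^^ 8) (subst id s) (subst id (rake s))"
  by (induction s rule: rake.induct) (auto intro: steps_cong steps_unassoc simp del: relpowp.simps)

lemma height_rake:
  "\<forall>b\<in>set_tm s. height b \<le> h \<Longrightarrow> \<forall>b\<in>set_tm (rake s). height b \<le> Suc h"
  by (induction s rule: rake.induct) (auto simp: le_Suc_eq)

section \<open>Reordering children and counting the remaining blocks\<close>

primrec is_leaf :: "'a tm \<Rightarrow> bool" where
  "is_leaf (Lf a) \<longleftrightarrow> True"
| "is_leaf (Nd s t) \<longleftrightarrow> False"

primrec lefty :: "'a tm \<Rightarrow> 'a tm" where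
  "lefty (Lf a) = Lf a"
| "lefty (Nd s t) = (if is_leaf t then Nd (lefty t) (lefty s) else Nd (lefty s) (lefty t))"

primrec left_leaning :: "'a tm \<Rightarrow> bool" where
  "left_leaning (Lf a) \<longleftrightarrow> True"
| "left_leaning (Nd s t) \<longleftrightarrow> left_leaning s \<and> left_leaning t \<and> (is_leaf t \<longrightarrow> is_leaf s)"

lemma is_leaf_lefty [simp]: "is_leaf (lefty t) = is_leaf t"
  by (cases t) auto

lemma left_leaning_lefty [simp]: "left_leaning (lefty t)"
  by (induction t) auto

text \<open>One round suffices, as \<open>par_swap\<close> can act at all nodes at once.\<close>

lemma par_lefty: "par (subst \<sigma> t) (subst \<sigma> (lefty t))"
  by (induction t) (auto intro: par.intros)

lemma set_lefty [simp]: "set_tm (lefty t) = set_tm t"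
  by (induction t) auto

lemma length_lefty [simp]: "length (leaf_list (lefty t)) = length (leaf_list t)"
  by (induction t) auto

lemma leaf_list_nonempty [simp]: "leaf_list t \<noteq> []"
  by (induction t) auto

lemma length_leaf_list_pos: "0 < length (leaf_list t)"
  by simp

lemma length_leaf_list_1D:
  assumes "length (leaf_list t) = 1"
  obtains a where "t = Lf a"
proof (cases t)
  case (Nd x y)
  have "length (leaf_list x) + length (leaf_list y) = 1" using assms Nd by simp
  then show thesis using length_leaf_list_pos[of x] length_leaf_list_pos[of y] by linarith
qed (rule that)

lemma length_leaf: "is_leaf t \<Longrightarrow> length (leaf_list t) = 1"
  by (cases t) auto

text \<open>In a left-leaning skeleton, a left leaf that \<open>rake\<close> passes unpaired has a
  bushy right sibling. The leaf adds 4 to the left side of the inequality below and 3 to the right;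
  the surplus 2 of the sibling absorbs this and leaves 1.\<close>

primrec bushy :: "'a tm \<Rightarrow> bool" where
  "bushy (Lf a) \<longleftrightarrow> False"
| "bushy (Nd s t) \<longleftrightarrow> \<not> is_leaf s \<and> \<not> is_leaf t"

text \<open>The sharper constant for bushy skeletons is needed when \<open>rake\<close> passes a single leaf.\<close>

lemma length_rake:
  "left_leaning s \<Longrightarrow>
    (if is_leaf s then length (leaf_list (rake s)) = 1
     else 4 * length (leaf_list (rake s)) + (if bushy s then 2 else 1) \<le> 3 * length (leaf_list s))"
proof (induction s rule: rake.induct)
  \<comment> \<open>This is tight if \<open>y\<close> is a leaf: three blocks become two, and
    \<open>4 * 2 + 1 = 3 * 3\<close>.\<close>
  case (3 a b y)
  then show ?case by (cases y) auto
next
  case ("4_1" x1 x2 y)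
  then show ?case by (cases y) (auto split: if_splits)
next
  case ("4_2" x y1 y2 y)
  then show ?case by (auto dest: length_leaf split: if_splits)
next
  case ("4_3" x y1 y2 y)
  then show ?case using length_leaf[of x] by (cases "is_leaf x") auto
qed auto

text \<open>The premise says that there are at most \<open>(4 / 3) ^ j\<close> blocks. One raking
  takes 9 rounds, 1 for \<open>lefty\<close> and 8 for \<open>rake\<close>; it leaves at most three
  quarters of the blocks and raises their heights by at most one.\<close>

lemma steps_balance_blocks:
  "\<lbrakk>3 ^ j * length (leaf_list s) \<le> 4 ^ j; \<forall>b\<in>set_tm s. height b \<le> h\<rbrakk>
    \<Longrightarrow> \<exists>t. (par ^^ (9 * j)) (subst id s) t \<and> height t \<le> h + j"
proof (induction j arbitrary: s h)
  case 0
  have "length (leaf_list s) \<le> 1" using 0(1) by simp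
  then have "length (leaf_list s) = 1" using length_leaf_list_pos[of s] by linarith
  then obtain b where "s = Lf b" by (rule length_leaf_list_1D)
  then have "(par ^^ (9 * 0)) (subst id s) b \<and> height b \<le> h + 0" using 0(2) by simp
  then show ?case by (rule exI)
next
  case (Suc j)
  show ?case
  proof (cases s)
    \<comment> \<open>A single block cannot shrink further; the remaining rounds are idle.\<close>
    case (Lf b)
    then have "(par ^^ (9 * Suc j)) (subst id s) b \<and> height b \<le> h + Suc j"
      using Suc.prems(2) by (simp add: trans_le_add1 del: relpowp.simps mult_Suc_right)
    then show ?thesis by (rule exI)
  next
    case (Nd x y)
    let ?r = "rake (lefty s)"
    have "4 * length (leaf_list ?r) \<le> 3 * length (leaf_list s)"
      using length_rake[of "lefty s"] Nd by (auto split: if_splits)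
    then have "3 ^ j * (4 * length (leaf_list ?r)) \<le> 3 ^ j * (3 * length (leaf_list s))"
      by (rule mult_le_mono2)
    also have "\<dots> \<le> 4 * 4 ^ j" using Suc.prems(1) by (simp add: ac_simps)
    finally have "3 ^ j * length (leaf_list ?r) \<le> 4 ^ j" by simp
    moreover have "\<forall>b\<in>set_tm ?r. height b \<le> Suc h"
      using height_rake[of "lefty s" h] Suc.prems(2) by simp
    ultimately obtain t where t: "(par ^^ (9 * j)) (subst id ?r) t" "height t \<le> Suc h + j"
      using Suc.IH by blast
    have "(par ^^ 1) (subst id s) (subst id (lefty s))" using par_lefty by (rule par_steps) simp
    from steps_add[OF steps_add[OF this steps_rake] t(1)]
    have "(par ^^ (9 * Suc j)) (subst id s) t" by (simp add: algebra_simps del: relpowp.simps)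
    moreover have "height t \<le> h + Suc j" using t(2) by simp
    ultimately show ?thesis by (intro exI conjI)
  qed
qed

section \<open>From an arbitrary term to a balanced one and on to the trie\<close>

lemma subst_Lf: "subst id (map_tm Lf t) = t"
  by (induction t) auto

lemma steps_balance:
  assumes "3 ^ j * length (leaf_list t) \<le> 4 ^ j"
  shows "\<exists>u. (par ^^ (9 * j)) t u \<and> height u \<le> j"
proof -
  have "leaf_list (map_tm Lf t) = map Lf (leaf_list t)" by (induction t) auto
  then have "3 ^ j * length (leaf_list (map_tm Lf t)) \<le> 4 ^ j" using assms by simp
  moreover have "\<forall>b\<in>set_tm (map_tm Lf t). height b \<le> 0" by (auto simp: tm.set_map)
  ultimately show ?thesis using steps_balance_blocks[of j "map_tm Lf t" 0] by (simp add: subst_Lf)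
qed

text \<open>Both terms reach the trie of their common labels, and the second run is reversed. Per
  bit, balancing takes \<open>9 * 3\<close> rounds, the delay \<open>8 * 3\<close> and the trie
  levels 8: together 59, and 118 for both directions.\<close>

lemma steps_between:
  fixes s t :: "nat tm"
  assumes s: "distinct (leaf_list s)" and st: "mset (leaf_list s) = mset (leaf_list t)"
    and m: "set_tm s \<subseteq> {..<2 ^ m}"
  shows "(par ^^ (118 * m)) s t"
proof -
  let ?q = "\<lambda>i a. bit (a::nat) i"
  have sep: "separated ?q m (set_tm s)"
    unfolding separated_def
  proof (intro ballI impI)
    fix a b assume "a \<in> set_tm s" "b \<in> set_tm s" and eq: "\<forall>i<m. bit a i = bit b i"
    then have "a < 2 ^ m" "b < 2 ^ m" using m by blast+
    then have "take_bit m a = a" "take_bit m b = b" by (simp_all add: take_bit_nat_eq_self_iff)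
    moreover have "take_bit m a = take_bit m b"
    proof (rule bit_eqI)
      show "bit (take_bit m a) i = bit (take_bit m b) i" for i
        unfolding bit_take_bit_iff using eq by blast
    qed
    ultimately show "a = b" by metis
  qed
  have *: "(par ^^ (59 * m)) u (trie ?q m (set_tm s))"
    if u: "mset (leaf_list u) = mset (leaf_list s)" for u
  proof -
    have "length (leaf_list s) = card (set_tm s)" using distinct_card[OF s] by simp
    also have "\<dots> \<le> 2 ^ m" using card_mono[OF _ m] by simp
    finally have "length (leaf_list u) \<le> 2 ^ m" using mset_eq_length[OF u] by simp
    then have "3 ^ (3 * m) * length (leaf_list u) \<le> 3 ^ (3 * m) * 2 ^ m" by simp
    \<comment> \<open>Per bit, \<open>3 ^ 3 * 2 = 54\<close> is at most \<open>4 ^ 3 = 64\<close>: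
      three rakings more than halve the number of blocks, so \<open>3 * m\<close> of them
      suffice.\<close>
    also have "\<dots> = (54::nat) ^ m" by (simp add: power_mult power_mult_distrib[symmetric])
    also have "\<dots> \<le> 4 ^ (3 * m)" by (simp add: power_mult power_mono)
    finally obtain v where v: "(par ^^ (9 * (3 * m))) u v" "height v \<le> 3 * m"
      using steps_balance by blast
    have eq: "mset (leaf_list v) = mset (leaf_list s)" using steps_leaf_list[OF v(1)] u by simp
    then have "distinct (leaf_list v)" using s mset_eq_imp_distinct_iff by blast
    moreover have [simp]: "set_tm v = set_tm s" using mset_eq_setD[OF eq] by simp
    ultimately have "(par ^^ (8 * height v + 8 * m)) v (trie ?q m (set_tm s))"
      using steps_trie[of v ?q m] sep by simp
    then have "(par ^^ (8 * (3 * m) + 8 * m)) v (trie ?q m (set_tm s))"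
      by (rule steps_mono) (use v(2) in simp)
    from steps_add[OF v(1) this] show ?thesis by (simp add: algebra_simps del: relpowp.simps)
  qed
  from steps_add[OF *[OF refl] steps_sym[OF *[OF st[symmetric]]]]
  show ?thesis by (simp add: algebra_simps del: relpowp.simps)
qed

section \<open>Terms with named vertices\<close>

text \<open>A leaf carries its vertex and its label.\<close>

datatype 'v dt = DL 'v nat | DN 'v "'v dt" "'v dt"

primrec apex :: "'v dt \<Rightarrow> 'v" where
  "apex (DL v i) = v"
| "apex (DN v l r) = v"

primrec shape :: "'v dt \<Rightarrow> nat tm" where
  "shape (DL v i) = Lf i"
| "shape (DN v l r) = Nd (shape l) (shape r)"

primrec inner :: "'v dt \<Rightarrow> 'v set set" where
  "inner (DL v i) = {}"
| "inner (DN v l r) = {{v, apex l}, {v, apex r}} \<union> (inner l \<union> inner r)"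

primrec tips :: "'v dt \<Rightarrow> ('v \<times> nat) set" where
  "tips (DL v i) = {(v, i)}"
| "tips (DN v l r) = tips l \<union> tips r"

primrec proper :: "'v dt \<Rightarrow> bool" where
  "proper (DL v i) \<longleftrightarrow> True"
| "proper (DN v l r) \<longleftrightarrow> v \<notin> set_dt l \<and> v \<notin> set_dt r \<and> set_dt l \<inter> set_dt r = {} \<and>
     proper l \<and> proper r"

text \<open>\<open>F\<close> is the part of a graph outside of the subtree \<open>d\<close>, which hangs at the vertex \<open>p\<close>.\<close>

definition attached :: "'v set set \<Rightarrow> 'v \<Rightarrow> 'v dt \<Rightarrow> bool" where
  "attached F p d \<longleftrightarrow> p \<notin> set_dt d \<and> {p, apex d} \<in> F \<and>
     (\<forall>f\<in>F. f \<inter> set_dt d \<noteq> {} \<longrightarrow> f = {p, apex d})"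

section \<open>Edges and valences of a subtree inside a larger graph\<close>

lemma finite_set_dt [simp]: "finite (set_dt d)"
  by (induction d) auto

lemma apex_in [simp]: "apex d \<in> set_dt d"
  by (cases d) auto

lemma inner_subset: "e \<in> inner d \<Longrightarrow> e \<subseteq> set_dt d"
  by (induction d) auto

lemma tips_subset: "fst ` tips d \<subseteq> set_dt d"
  by (induction d) auto

lemma snd_tips: "snd ` tips d = set_tm (shape d)"
  by (induction d) (auto simp: image_Un)

lemma inner_card: "proper d \<Longrightarrow> e \<in> inner d \<Longrightarrow> card e = 2"
proof (induction d)
  case (DN v l r)
  have "v \<noteq> apex l" "v \<noteq> apex r"
    using DN.prems(1) apex_in[of l] apex_in[of r] by (metis proper.simps(2))+
  then have "card {v, apex l} = 2" "card {v, apex r} = 2" by simp_all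
  then show ?case using DN by auto
qed simp

text \<open>Descending into \<open>l\<close>, the outside grows by the two edges below
  \<open>v\<close> and by the sibling subtree. Properness keeps all of these away from
  \<open>l\<close>, except for the edge to its apex.\<close>

lemma attached_left:
  assumes "attached F p (DN v l r)" "proper (DN v l r)"
  shows "attached (F \<union> {{v, apex l}, {v, apex r}} \<union> inner r) v l"
  unfolding attached_def
proof (intro conjI ballI impI)
  show "v \<notin> set_dt l" using assms by simp
  show "{v, apex l} \<in> F \<union> {{v, apex l}, {v, apex r}} \<union> inner r" by simp
next
  fix f assume f: "f \<in> F \<union> {{v, apex l}, {v, apex r}} \<union> inner r" "f \<inter> set_dt l \<noteq> {}"
  have "f \<notin> F"
  proof
    assume "f \<in> F"
    then have "f = {p, v}" "p \<notin> set_dt l" using assms(1) f(2) by (auto simp: attached_def)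
    then show False using f(2) assms(2) by auto
  qed
  moreover have "f \<notin> inner r" using inner_subset[of f r] f(2) assms(2) by auto
  moreover have "f \<noteq> {v, apex r}" using f(2) assms(2) apex_in[of r] by auto
  ultimately show "f = {v, apex l}" using f(1) by blast
qed

lemma attached_swap: "attached F p (DN v l r) \<Longrightarrow> attached F p (DN v r l)"
  by (auto simp: attached_def)

lemma proper_swap: "proper (DN v l r) \<Longrightarrow> proper (DN v r l)"
  by auto

lemma attached_right:
  assumes "attached F p (DN v l r)" "proper (DN v l r)"
  shows "attached (F \<union> {{v, apex l}, {v, apex r}} \<union> inner l) v r"
  using attached_left[OF attached_swap[OF assms(1)] proper_swap[OF assms(2)]]
  unfolding insert_commute[of "{v, apex r}" "{v, apex l}"] .

lemma star_node:
  assumes "attached F p (DN v l r)" "proper (DN v l r)"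
  shows "{e \<in> F \<union> inner (DN v l r). v \<in> e} = {{v, p}, {v, apex l}, {v, apex r}}"
proof -
  have "v \<in> set_dt (DN v l r)" by simp
  then have "e = {v, p}" if "e \<in> F" "v \<in> e" for e
    using assms(1) that unfolding attached_def by (metis apex.simps(2) disjoint_iff insert_commute)
  moreover have "{v, p} \<in> F" using assms(1) by (simp add: attached_def insert_commute)
  ultimately have F: "{e \<in> F. v \<in> e} = {{v, p}}" by blast
  have "v \<notin> e" if "e \<in> inner l \<union> inner r" for e
    using that assms(2) inner_subset[of e l] inner_subset[of e r] by auto
  then have "{e \<in> inner l \<union> inner r. v \<in> e} = {}" by blast
  then have "{e \<in> inner (DN v l r). v \<in> e} = {{v, apex l}, {v, apex r}}"
    by (simp only: inner.simps) blast
  moreover have "{e \<in> F \<union> inner (DN v l r). v \<in> e} = {e \<in> F. v \<in> e} \<union> {e \<in> inner (DN v l r). v \<in> e}"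
    by blast
  ultimately show ?thesis unfolding F by (simp only: insert_is_Un[symmetric])
qed

lemma card_star:
  assumes "attached F p d" "proper d" "x \<in> set_dt d"
  shows "card {e \<in> F \<union> inner d. x \<in> e} = (if x \<in> fst ` tips d then 1 else 3)"
  using assms
proof (induction d arbitrary: F p)
  case (DL v i)
  then have "{e \<in> F. v \<in> e} = {{p, v}}" by (auto simp: attached_def)
  then show ?case using DL by simp
next
  case (DN v l r)
  \<comment> \<open>Descending changes only the division of the edges into outside and inside, so
    the stars counted stay the same.\<close>
  have L: "F \<union> {{v, apex l}, {v, apex r}} \<union> inner r \<union> inner l = F \<union> inner (DN v l r)"
    "F \<union> {{v, apex l}, {v, apex r}} \<union> inner l \<union> inner r = F \<union> inner (DN v l r)"
    by auto
  note IHl = DN.IH(1)[OF attached_left[OF DN.prems(1,2)], unfolded L]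
  note IHr = DN.IH(2)[OF attached_right[OF DN.prems(1,2)], unfolded L]
  from DN.prems(3) consider "x = v" | "x \<in> set_dt l" | "x \<in> set_dt r" by auto
  then show ?case
  proof cases
    case 1
    have "p \<notin> set_dt l" "p \<notin> set_dt r" using DN.prems(1) by (simp_all add: attached_def)
    then have "p \<noteq> apex l" "p \<noteq> apex r" by (metis apex_in)+
    moreover have "apex l \<noteq> apex r" using DN.prems(2) apex_in[of l] apex_in[of r] by (metis disjoint_iff proper.simps(2))
    ultimately have "card {{v, p}, {v, apex l}, {v, apex r}} = 3" by (auto simp: doubleton_eq_iff)
    moreover have "v \<notin> fst ` tips (DN v l r)" using DN.prems(2) tips_subset[of l] tips_subset[of r] by auto
    ultimately show ?thesis unfolding 1 star_node[OF DN.prems(1,2)] by simp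
  next
    case 2
    then have "x \<notin> fst ` tips r" using DN.prems(2) tips_subset[of r] by auto
    then show ?thesis using IHl 2 DN.prems(2) by (simp add: image_Un del: inner.simps)
  next
    case 3
    then have "x \<notin> fst ` tips l" using DN.prems(2) tips_subset[of l] by auto
    then show ?thesis using IHr 3 DN.prems(2) by (simp add: image_Un del: inner.simps)
  qed
qed

section \<open>Lifting parallel rotations to lists of disjoint Whitehead moves\<close>

lemma whitehead_moves_append:
  "whitehead_moves T es T' \<Longrightarrow> whitehead_moves T' fs T'' \<Longrightarrow> whitehead_moves T (es @ fs) T''"
  by (induction rule: whitehead_moves.induct) (auto intro: whitehead_moves.intros)

lemma edges_update_twice: "T\<lparr>edges := E\<rparr>\<lparr>edges := E'\<rparr> = T\<lparr>edges := E'\<rparr>" for T :: ltree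
  by simp

text \<open>\<open>W\<close> is a set of vertices that the moved edges avoid, so that they can be used by further moves.\<close>

definition realizable :: "nat set \<Rightarrow> nat dt \<Rightarrow> nat dt \<Rightarrow> bool" where
  "realizable W d d' \<longleftrightarrow> (\<forall>F p T. attached F p d \<longrightarrow> edges T = F \<union> inner d \<longrightarrow>
     (\<exists>es. whitehead_moves T es (T\<lparr>edges := F \<union> inner d'\<rparr>) \<and> sorted_wrt disjnt es \<and>
       (\<forall>e\<in>set es. e \<in> inner d \<and> e \<inter> fst ` tips d = {} \<and> e \<inter> W = {})))"

lemma realizableD:
  assumes "realizable W d d'" "attached F p d" "edges T = F \<union> inner d"
  obtains es where "whitehead_moves T es (T\<lparr>edges := F \<union> inner d'\<rparr>)" "sorted_wrt disjnt es"
    "\<forall>e\<in>set es. e \<in> inner d \<and> e \<inter> fst ` tips d = {} \<and> e \<inter> W = {}"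
  using assms unfolding realizable_def by meson

text \<open>Besides properness, these are the data of \<open>d\<close> visible from the rest of the
  tree, so \<open>d'\<close> can hang at the same edge in its place.\<close>

definition similar :: "'v dt \<Rightarrow> 'v dt \<Rightarrow> bool" where
  "similar d d' \<longleftrightarrow> proper d' \<and> set_dt d' = set_dt d \<and> apex d' = apex d \<and> tips d' = tips d"

definition liftable :: "nat set \<Rightarrow> nat dt \<Rightarrow> nat dt \<Rightarrow> bool" where
  "liftable W d d' \<longleftrightarrow> similar d d' \<and> realizable W d d'"

lemma liftable_refl: "proper d \<Longrightarrow> liftable W d d"
  unfolding liftable_def realizable_def
proof (intro conjI allI impI)
  show "similar d d" if "proper d" using that by (simp add: similar_def)
next
  fix F p and T :: ltree assume "edges T = F \<union> inner d"
  then have "T\<lparr>edges := F \<union> inner d\<rparr> = T" by (cases T) simp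
  then show "\<exists>es. whitehead_moves T es (T\<lparr>edges := F \<union> inner d\<rparr>) \<and> sorted_wrt disjnt es \<and>
      (\<forall>e\<in>set es. e \<in> inner d \<and> e \<inter> fst ` tips d = {} \<and> e \<inter> W = {})"
    by (intro exI[of _ "[]"]) (simp add: whitehead_moves.Nil)
qed

lemma liftable_weaken: "liftable W d d' \<Longrightarrow> liftable {} d d'"
  unfolding liftable_def realizable_def by (metis Int_empty_right)

text \<open>The left moves are made first, with \<open>r\<close> as part of the outside, and then
  the right moves. The moved edges lie inside the two disjoint subtrees, so they are disjoint from
  each other and also avoid \<open>v\<close>.\<close>

lemma liftable_cong:
  assumes l: "liftable W l l'" and r: "liftable W' r r'" and d: "proper (DN v l r)"
    and W: "W \<subseteq> set_dt l" "W' \<subseteq> set_dt r"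
  shows "liftable (insert v (W \<union> W')) (DN v l r) (DN v l' r')"
proof -
  have l': "proper l'" "set_dt l' = set_dt l" "apex l' = apex l" "tips l' = tips l"
    and r': "proper r'" "set_dt r' = set_dt r" "apex r' = apex r" "tips r' = tips r"
    using l r by (simp_all add: liftable_def similar_def)
  have rl: "realizable W l l'" and rr: "realizable W' r r'"
    using l r by (simp_all add: liftable_def)
  have d': "proper (DN v l' r)" using d l' by simp
  have ex: "\<exists>es. whitehead_moves T es (T\<lparr>edges := F \<union> inner (DN v l' r')\<rparr>) \<and> sorted_wrt disjnt es \<and>
         (\<forall>e\<in>set es. e \<in> inner (DN v l r) \<and> e \<inter> fst ` tips (DN v l r) = {} \<and>
            e \<inter> insert v (W \<union> W') = {})"
    if at: "attached F p (DN v l r)" and T: "edges T = F \<union> inner (DN v l r)" for F p T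
  proof -
    let ?F = "F \<union> {{v, apex l}, {v, apex r}}"
    have T': "edges T = ?F \<union> inner r \<union> inner l" using T by auto
    obtain es where es: "whitehead_moves T es (T\<lparr>edges := ?F \<union> inner r \<union> inner l'\<rparr>)"
        "sorted_wrt disjnt es"
        "\<forall>e\<in>set es. e \<in> inner l \<and> e \<inter> fst ` tips l = {} \<and> e \<inter> W = {}"
      by (rule realizableD[OF rl attached_left[OF at d] T'])
    let ?T = "T\<lparr>edges := ?F \<union> inner r \<union> inner l'\<rparr>"
    have "attached F p (DN v l' r)" using at l' by (simp add: attached_def)
    from attached_right[OF this d'] have at': "attached (?F \<union> inner l') v r" using l' by simp
    have T'': "edges ?T = ?F \<union> inner l' \<union> inner r" by auto
    obtain fs where fs: "whitehead_moves ?T fs (?T\<lparr>edges := ?F \<union> inner l' \<union> inner r'\<rparr>)"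
        "sorted_wrt disjnt fs"
        "\<forall>e\<in>set fs. e \<in> inner r \<and> e \<inter> fst ` tips r = {} \<and> e \<inter> W' = {}"
      by (rule realizableD[OF rr at' T''])
    have "?F \<union> inner l' \<union> inner r' = F \<union> inner (DN v l' r')"
      using l'(3) r'(3) by auto
    then have eq: "?T\<lparr>edges := ?F \<union> inner l' \<union> inner r'\<rparr> = T\<lparr>edges := F \<union> inner (DN v l' r')\<rparr>"
      by (simp only: edges_update_twice)
    have sub: "e \<subseteq> set_dt l" if "e \<in> set es" for e
      using bspec[OF es(3) that] by (simp add: inner_subset)
    have sub': "e \<subseteq> set_dt r" if "e \<in> set fs" for e
      using bspec[OF fs(3) that] by (simp add: inner_subset)
    have disj: "set_dt l \<inter> set_dt r = {}" "v \<notin> set_dt l" "v \<notin> set_dt r" using d by auto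
    have "disjnt e f" if "e \<in> set es" "f \<in> set fs" for e f
      using sub[OF that(1)] sub'[OF that(2)] disj(1) unfolding disjnt_def by blast
    then have sorted: "sorted_wrt disjnt (es @ fs)" using es(2) fs(2) by (simp add: sorted_wrt_append)
    have props: "e \<in> inner (DN v l r) \<and> e \<inter> fst ` tips (DN v l r) = {} \<and> e \<inter> insert v (W \<union> W') = {}"
      if e: "e \<in> set (es @ fs)" for e
    proof (cases "e \<in> set es")
      case True
      have "e \<inter> fst ` tips r = {}" "v \<notin> e" "e \<inter> W' = {}"
        using sub[OF True] W tips_subset[of r] disj by blast+
      then show ?thesis using bspec[OF es(3) True]
        by (simp add: image_Un Int_Un_distrib Int_insert_right)
    next
      case False
      then have e: "e \<in> set fs" using e by simp
      have "e \<inter> fst ` tips l = {}" "v \<notin> e" "e \<inter> W = {}"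
        using sub'[OF e] W tips_subset[of l] disj by blast+
      then show ?thesis using bspec[OF fs(3) e]
        by (simp add: image_Un Int_Un_distrib Int_insert_right)
    qed
    show ?thesis
      using whitehead_moves_append[OF es(1) fs(1)] sorted ballI[OF props] unfolding eq
      by (intro exI[of _ "es @ fs"] conjI)
  qed
  have "realizable (insert v (W \<union> W')) (DN v l r) (DN v l' r')"
    unfolding realizable_def by (intro allI impI) (rule ex)
  moreover have "similar (DN v l r) (DN v l' r')" using d l' r' by (simp add: similar_def)
  ultimately show ?thesis unfolding liftable_def by blast
qed

text \<open>Both orders of the children have the same edge set, so a swap needs no Whitehead
  move.\<close>

lemma liftable_swap:
  assumes "liftable W (DN v l r) (DN v l' r')"
  shows "liftable W (DN v l r) (DN v r' l')"
proof -
  have "inner (DN v r' l') = inner (DN v l' r')" "tips (DN v r' l') = tips (DN v l' r')"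
    "set_dt (DN v r' l') = set_dt (DN v l' r')" "apex (DN v r' l') = apex (DN v l' r')"
    "proper (DN v r' l') = proper (DN v l' r')" by auto
  then show ?thesis using assms unfolding liftable_def realizable_def similar_def by metis
qed

lemma neighbors_star:
  assumes "{e \<in> edges T. x \<in> e} = {{x, i}, {x, j}, {x, k}}"
  shows "neighbors T x = {i, j, k}"
proof -
  have "w \<in> neighbors T x \<longleftrightarrow> {x, w} \<in> {e \<in> edges T. x \<in> e}" for w
    by (simp add: neighbors_def)
  then show ?thesis unfolding assms by (auto simp: doubleton_eq_iff)
qed

lemma whitehead_moveI:
  assumes "{u, v} \<in> interior_edges T" "u \<noteq> v"
    "P \<union> Q = (neighbors T u - {v}) \<union> (neighbors T v - {u})" "P \<inter> Q = {}" "card P = 2" "card Q = 2"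
    "{P, Q} \<noteq> {neighbors T u - {v}, neighbors T v - {u}}"
  shows "whitehead_move T {u, v} (T\<lparr>edges := {e \<in> edges T. disjnt e {u, v}} \<union> {{u, v}} \<union>
    {{u, x} | x. x \<in> P} \<union> {{v, x} | x. x \<in> Q}\<rparr>)"
  unfolding whitehead_move_def
  by (intro conjI exI[of _ u] exI[of _ v] exI[of _ P] exI[of _ Q] refl assms)

text \<open>Collapsing \<open>{u, v}\<close> joins \<open>p\<close> and the apexes of
  \<open>a\<close>, \<open>b\<close>, \<open>c\<close> at one vertex. Reopening it with
  \<open>p\<close> and \<open>b\<close> at \<open>u\<close>, and \<open>a\<close> and
  \<open>c\<close> at \<open>v\<close>, is the rotation.\<close>

lemma whitehead_move_rot:
  assumes d: "proper (DN u (DN v a b) c)" and at: "attached F p (DN u (DN v a b) c)"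
    and T: "edges T = F \<union> inner (DN u (DN v a b) c)"
  shows "whitehead_move T {u, v} (T\<lparr>edges := F \<union> inner (DN u (DN v a c) b)\<rparr>)"
proof -
  define i j k where ijk: "i = apex a" "j = apex b" "k = apex c"
  have in_ijk: "i \<in> set_dt a" "j \<in> set_dt b" "k \<in> set_dt c" by (simp_all add: ijk)
  have dist: "u \<noteq> v" "p \<noteq> u" "p \<noteq> v" "p \<noteq> i" "p \<noteq> j" "p \<noteq> k" "u \<noteq> i" "u \<noteq> j" "u \<noteq> k"
      "v \<noteq> i" "v \<noteq> j" "v \<noteq> k" "i \<noteq> j" "i \<noteq> k" "j \<noteq> k"
    using d at in_ijk unfolding attached_def by auto
  have "{e \<in> edges T. u \<in> e} = {{u, p}, {u, v}, {u, k}}"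
    using star_node[OF at d] unfolding T ijk by simp
  note nu = neighbors_star[OF this]
  have "F \<union> {{u, v}, {u, k}} \<union> inner c \<union> inner (DN v a b) = edges T"
    unfolding T ijk by auto
  moreover have "proper (DN v a b)" using d by simp
  ultimately have "{e \<in> edges T. v \<in> e} = {{v, u}, {v, i}, {v, j}}"
    using star_node[of "F \<union> {{u, v}, {u, k}} \<union> inner c" u v a b] attached_left[OF at d]
    unfolding ijk by simp
  note nv = neighbors_star[OF this]
  have "{u, v} \<in> edges T" unfolding T by simp
  moreover have "valence T x = 3" if "x \<in> {u, v}" for x
  proof -
    have "x \<notin> fst ` tips (DN u (DN v a b) c)"
      using d that tips_subset[of a] tips_subset[of b] tips_subset[of c] by auto
    then show ?thesis unfolding valence_def T
      using card_star[OF at d, of x] that by auto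
  qed
  ultimately have interior: "{u, v} \<in> interior_edges T" unfolding interior_edges_def by simp
  \<comment> \<open>The only outside edge meeting \<open>{u, v}\<close> is \<open>{u, p}\<close>;
    the move deletes it and puts it back.\<close>
  have F: "F = {e \<in> F. disjnt e {u, v}} \<union> {{u, p}}"
    using at by (auto simp: attached_def disjnt_def insert_commute)
  have sub: "disjnt e {u, v}" if "e \<in> inner a \<union> inner b \<union> inner c" for e
    using that d inner_subset[of e a] inner_subset[of e b] inner_subset[of e c]
    by (auto simp: disjnt_def)
  have T': "{e \<in> edges T. disjnt e {u, v}} = {e \<in> F. disjnt e {u, v}} \<union> (inner a \<union> inner b \<union> inner c)"
    unfolding T using sub by (auto simp: disjnt_def)
  have F': "F \<union> inner (DN u (DN v a c) b) =
      {e \<in> F. disjnt e {u, v}} \<union> {{u, p}} \<union> (inner a \<union> inner b \<union> inner c) \<union> {{u, v}, {u, j}, {v, i}, {v, k}}"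
    unfolding ijk by (subst F) auto
  have eqs: "{{u, x} | x. x \<in> {p, j}} = {{u, p}, {u, j}}" "{{v, x} | x. x \<in> {i, k}} = {{v, i}, {v, k}}"
    by auto
  have rearrange: "X \<union> {a} \<union> I \<union> {b, c, d, e} = X \<union> I \<union> {b} \<union> {a, c} \<union> {d, e}"
    for X I and a b c d e :: "nat set" by auto
  have edges: "F \<union> inner (DN u (DN v a c) b) =
      {e \<in> edges T. disjnt e {u, v}} \<union> {{u, v}} \<union> {{u, x} | x. x \<in> {p, j}} \<union> {{v, x} | x. x \<in> {i, k}}"
    unfolding F' T' eqs by (rule rearrange)
  have "{p, j} \<union> {i, k} = (neighbors T u - {v}) \<union> (neighbors T v - {u})"
    "{p, j} \<inter> {i, k} = {}" "card {p, j} = 2" "card {i, k} = 2"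
    "{{p, j}, {i, k}} \<noteq> {neighbors T u - {v}, neighbors T v - {u}}"
    unfolding nu nv using dist by (auto simp: doubleton_eq_iff)
  from whitehead_moveI[OF interior dist(1) this] show ?thesis unfolding edges .
qed

text \<open>The edge \<open>{u, v}\<close> is moved first. The later moves avoid \<open>u\<close>
  and \<open>v\<close>, so their edges are disjoint from it and already present before the
  rotation.\<close>

lemma liftable_rot:
  assumes d: "proper (DN u (DN v a b) c)"
    and lift: "liftable {u, v} (DN u (DN v a c) b) d'"
  shows "liftable {} (DN u (DN v a b) c) d'"
proof -
  let ?d = "DN u (DN v a b) c" and ?d1 = "DN u (DN v a c) b"
  have "set_dt ?d1 = set_dt ?d" by (simp only: dt.set) blast
  moreover have tips: "tips ?d1 = tips ?d" by (simp only: tips.simps) blast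
  moreover have "apex ?d1 = apex ?d" by (simp only: apex.simps)
  moreover have "similar ?d1 d'" using lift by (simp only: liftable_def)
  ultimately have same: "similar ?d d'" unfolding similar_def by metis
  have real: "realizable {u, v} ?d1 d'" using lift by (simp only: liftable_def)
  have ex: "\<exists>es. whitehead_moves T es (T\<lparr>edges := F \<union> inner d'\<rparr>) \<and> sorted_wrt disjnt es \<and>
         (\<forall>e\<in>set es. e \<in> inner ?d \<and> e \<inter> fst ` tips ?d = {} \<and> e \<inter> {} = {})"
    if at: "attached F p ?d" and T: "edges T = F \<union> inner ?d" for F p T
  proof -
    let ?T = "T\<lparr>edges := F \<union> inner ?d1\<rparr>"
    have at': "attached F p ?d1" using at by (auto simp: attached_def)
    have T': "edges ?T = F \<union> inner ?d1" by simp
    obtain es where es: "whitehead_moves ?T es (?T\<lparr>edges := F \<union> inner d'\<rparr>)"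
      "sorted_wrt disjnt es"
      "\<forall>e\<in>set es. e \<in> inner ?d1 \<and> e \<inter> fst ` tips ?d1 = {} \<and> e \<inter> {u, v} = {}"
      by (rule realizableD[OF real at' T'])
    have moves: "whitehead_moves T ({u, v} # es) (T\<lparr>edges := F \<union> inner d'\<rparr>)"
      using whitehead_moves.Cons[OF whitehead_move_rot[OF d at T] es(1)]
      by (simp only: edges_update_twice)
    have sorted: "sorted_wrt disjnt ({u, v} # es)"
    proof -
      have "disjnt {u, v} e" if "e \<in> set es" for e
        using bspec[OF es(3) that] unfolding disjnt_def by blast
      then show ?thesis using es(2) by simp
    qed
    have props: "e \<in> inner ?d \<and> e \<inter> fst ` tips ?d = {} \<and> e \<inter> {} = {}" if "e \<in> set ({u, v} # es)" for e
    proof (cases "e = {u, v}")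
      case True
      then show ?thesis using d tips_subset[of a] tips_subset[of b] tips_subset[of c] by auto
    next
      case False
      then have "e \<in> set es" using that by simp
      from bspec[OF es(3) this] have e: "e \<in> inner ?d1" "e \<inter> fst ` tips ?d1 = {}" "e \<inter> {u, v} = {}"
        by blast+
      \<comment> \<open>Avoiding \<open>u\<close> and \<open>v\<close>, the edge lies within
        \<open>a\<close>, \<open>b\<close> or \<open>c\<close>, which both arrangements
        share.\<close>
      then have "e \<in> inner ?d" by (simp only: inner.simps apex.simps) blast
      then show ?thesis using e(2) unfolding tips by blast
    qed
    show ?thesis using moves sorted ballI[OF props] by (intro exI[of _ "{u, v} # es"] conjI)
  qed
  have "realizable {} ?d d'" unfolding realizable_def by (intro allI impI) (rule ex)
  then show ?thesis using same by (simp only: liftable_def)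
qed

lemma par_liftable:
  "\<lbrakk>par t t'; shape d = t; proper d\<rbrakk> \<Longrightarrow> \<exists>d'. shape d' = t' \<and> liftable {} d d'"
proof (induction arbitrary: d rule: par.induct)
  case (par_leaf a)
  have "liftable {} d d" using par_leaf.prems(2) by (rule liftable_refl)
  then show ?case by (intro exI[of _ d] conjI par_leaf.prems(1))
next
  case (par_cong a a' b b')
  then obtain v l r where d: "d = DN v l r" "shape l = a" "shape r = b" by (cases d) auto
  have p: "proper l" "proper r" using par_cong.prems(2) d(1) by simp_all
  obtain l' where l': "shape l' = a' \<and> liftable {} l l'" using par_cong.IH(1)[OF d(2) p(1)] ..
  obtain r' where r': "shape r' = b' \<and> liftable {} r r'" using par_cong.IH(2)[OF d(3) p(2)] ..
  have lift: "liftable {} (DN v l r) (DN v l' r')"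
    using liftable_weaken[OF liftable_cong[of "{}" l l' "{}" r r' v]] l' r' par_cong.prems(2) d(1)
    by simp
  show ?case using lift l' r' d(1) by (intro exI[of _ "DN v l' r'"]) simp
next
  case (par_swap a a' b b')
  then obtain v l r where d: "d = DN v l r" "shape l = a" "shape r = b" by (cases d) auto
  have p: "proper l" "proper r" using par_swap.prems(2) d(1) by simp_all
  obtain l' where l': "shape l' = a' \<and> liftable {} l l'" using par_swap.IH(1)[OF d(2) p(1)] ..
  obtain r' where r': "shape r' = b' \<and> liftable {} r r'" using par_swap.IH(2)[OF d(3) p(2)] ..
  have lift: "liftable {} (DN v l r) (DN v l' r')"
    using liftable_weaken[OF liftable_cong[of "{}" l l' "{}" r r' v]] l' r' par_swap.prems(2) d(1)
    by simp
  show ?case using liftable_swap[OF lift] l' r' d(1) by (intro exI[of _ "DN v r' l'"]) simp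
next
  case (par_rot a a' b b' c c')
  then obtain u x y where d: "d = DN u x y" "shape x = Nd a b" "shape y = c" by (cases d) auto
  then obtain v l r where x: "x = DN v l r" "shape l = a" "shape r = b" by (cases x) auto
  have p: "proper (DN u (DN v l r) y)" using par_rot.prems(2) d(1) x(1) by simp
  have pl: "proper l" and pr: "proper r" and py: "proper y" using p by simp_all
  obtain l' where l': "shape l' = a' \<and> liftable {} l l'" using par_rot.IH(1)[OF x(2) pl] ..
  obtain r' where r': "shape r' = b' \<and> liftable {} r r'" using par_rot.IH(2)[OF x(3) pr] ..
  obtain y' where y': "shape y' = c' \<and> liftable {} y y'" using par_rot.IH(3)[OF d(3) py] ..
  \<comment> \<open>The moves of the subterms are lifted in the rotated arrangement, keeping
    \<open>u\<close> and \<open>v\<close> free, and the rotation is put in front of them.\<close>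
  have sub: "{v} \<subseteq> set_dt (DN v l y)" "{} \<subseteq> set_dt r" by simp_all
  have p1: "proper (DN v l y)" and p2: "proper (DN u (DN v l y) r)" using p by auto
  have "liftable {v} (DN v l y) (DN v l' y')"
    using liftable_cong[of "{}" l l' "{}" y y' v] l' y' p1 by simp
  from liftable_cong[OF this conjunct2[OF r'] p2 sub]
  have "liftable {u, v} (DN u (DN v l y) r) (DN u (DN v l' y') r')" by simp
  from liftable_rot[OF p this] show ?case using l' r' y' d(1) x(1)
    by (intro exI[of _ "DN u (DN v l' y') r'"]) simp
qed

section \<open>Labeled trees represented by terms\<close>

definition represents :: "nat \<Rightarrow> ltree \<Rightarrow> nat dt \<Rightarrow> bool" where
  "represents n T d \<longleftrightarrow> root T \<notin> set_dt d \<and> proper d \<and> verts T = insert (root T) (set_dt d) \<and>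
     edges T = insert {root T, apex d} (inner d) \<and> (\<forall>(v, i)\<in>tips d. end_at T i = v) \<and>
     set_tm (shape d) = {0..n}"

section \<open>Graphs represented by terms are labeled trees\<close>

lemma attached_root: "r \<notin> set_dt d \<Longrightarrow> attached {{r, apex d}} r d"
  by (simp add: attached_def)

lemma tips_unique: "proper d \<Longrightarrow> (v, i) \<in> tips d \<Longrightarrow> (v, j) \<in> tips d \<Longrightarrow> i = j"
proof (induction d)
  case (DN u l r)
  have "v \<in> set_dt l" if "(v, k) \<in> tips l" for k using tips_subset[of l] that by force
  moreover have "v \<in> set_dt r" if "(v, k) \<in> tips r" for k using tips_subset[of r] that by force
  ultimately show ?case using DN by (metis Un_iff disjoint_iff proper.simps(2) tips.simps(2))
qed simp

text \<open>A label \<open>i\<close> occurring on both sides would place the one vertex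
  \<open>f i\<close> in two disjoint subtrees.\<close>

lemma distinct_labels:
  "\<lbrakk>proper d; \<forall>(v, i)\<in>tips d. f i = v\<rbrakk> \<Longrightarrow> distinct (leaf_list (shape d))"
proof (induction d)
  case (DN u l r)
  have "set_tm (shape l) \<inter> set_tm (shape r) = {}"
  proof (rule ccontr)
    assume "set_tm (shape l) \<inter> set_tm (shape r) \<noteq> {}"
    then obtain i where "i \<in> snd ` tips l" "i \<in> snd ` tips r" unfolding snd_tips by blast
    then obtain v w where vw: "(v, i) \<in> tips l" "(w, i) \<in> tips r" by auto
    then have "f i = v" "f i = w" using DN.prems(2) by auto
    then have "v \<in> set_dt l" "v \<in> set_dt r" using vw tips_subset[of l] tips_subset[of r] by force+
    then show False using DN.prems(1) by auto
  qed
  moreover have "distinct (leaf_list (shape l))" "distinct (leaf_list (shape r))"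
    using DN by simp_all
  ultimately show ?case by simp
qed simp

text \<open>The absence of an \<open>is_cycle\<close>, stated for a bare edge set so that a tree can
  be built up edge by edge.\<close>

definition acyclic_edges :: "'v set set \<Rightarrow> bool" where
  "acyclic_edges E \<longleftrightarrow>
     (\<nexists>q. 3 \<le> length q \<and> distinct q \<and> (\<forall>i<length q. {q ! i, q ! (Suc i mod length q)} \<in> E))"

text \<open>A cycle through \<open>v\<close> would give it two different neighbors, but its only
  edge leads to \<open>p\<close>.\<close>

lemma acyclic_pendant:
  assumes E: "acyclic_edges E" and v: "v \<notin> \<Union>E" "v \<noteq> p"
  shows "acyclic_edges (insert {p, v} E)"
  unfolding acyclic_edges_def
proof (rule notI, elim exE conjE)
  fix q assume len: "3 \<le> length q" and dist: "distinct q"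
    and edge: "\<forall>i<length q. {q ! i, q ! (Suc i mod length q)} \<in> insert {p, v} E"
  show False
  proof (cases "v \<in> set q")
    case True
    then obtain i where i: "i < length q" "q ! i = v" by (auto simp: in_set_conv_nth)
    \<comment> \<open>\<open>j\<close> is the cyclic predecessor of \<open>i\<close>, wrapping
      around at 0, and \<open>k\<close> below is its successor.\<close>
    define j where "j = (if i = 0 then length q - 1 else i - 1)"
    have j: "j < length q" "Suc j mod length q = i" using i(1) by (auto simp: j_def)
    define k where "k = Suc i mod length q"
    have "0 < length q" using i(1) by linarith
    then have k: "k < length q" unfolding k_def by (rule mod_less_divisor)
    have "k = (if Suc i = length q then 0 else Suc i)" using i(1) by (simp add: k_def mod_Suc)
    \<comment> \<open>Length at least 3 matters here: on a cycle of length 2, predecessor and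
      successor coincide.\<close>
    then have "j \<noteq> k" using i(1) len by (auto simp: j_def split: if_splits)
    have only: "x = p" if "{v, x} \<in> insert {p, v} E" for x
      using that v by (auto simp: doubleton_eq_iff)
    have "{v, q ! k} \<in> insert {p, v} E"
      using edge[rule_format, OF i(1)] unfolding i(2) k_def .
    then have 1: "q ! k = p" by (rule only)
    have "{v, q ! j} \<in> insert {p, v} E"
      using edge[rule_format, OF j(1)] unfolding j(2) i(2) insert_commute[of "q ! j"] .
    then have "q ! j = p" by (rule only)
    then show False using 1 nth_eq_iff_index_eq[OF dist j(1) k] \<open>j \<noteq> k\<close> by simp
  next
    case False
    have "{q ! i, q ! (Suc i mod length q)} \<in> E" if "i < length q" for i
    proof -
      have "0 < length q" using that by linarith
      then have "Suc i mod length q < length q" by (rule mod_less_divisor)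
      then have "q ! i \<noteq> v" "q ! (Suc i mod length q) \<noteq> v" using False that nth_mem by metis+
      then have "{q ! i, q ! (Suc i mod length q)} \<noteq> {p, v}" by (simp add: doubleton_eq_iff)
      then show ?thesis using edge[rule_format, OF that] by (simp only: insert_iff) simp
    qed
    then show False using E len dist unfolding acyclic_edges_def by blast
  qed
qed

text \<open>The vertices are added in preorder, each as a pendant vertex of the graph built so
  far.\<close>

lemma acyclic_dt:
  "\<lbrakk>acyclic_edges E; proper d; set_dt d \<inter> insert p (\<Union>E) = {}\<rbrakk>
    \<Longrightarrow> acyclic_edges (insert {p, apex d} E \<union> inner d)"
proof (induction d arbitrary: E p)
  case (DL v i)
  then have "v \<notin> \<Union>E" "v \<noteq> p" by auto
  from acyclic_pendant[OF DL(1) this] show ?case by simp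
next
  case (DN v l r)
  have disj: "v \<notin> set_dt l" "v \<notin> set_dt r" "set_dt l \<inter> set_dt r = {}" "proper l" "proper r"
    "p \<notin> set_dt l" "p \<notin> set_dt r" "set_dt l \<inter> \<Union>E = {}" "set_dt r \<inter> \<Union>E = {}" "v \<notin> \<Union>E" "v \<noteq> p"
    using DN.prems by auto
  let ?E1 = "insert {p, v} E"
  let ?E2 = "insert {v, apex l} ?E1 \<union> inner l"
  have "acyclic_edges ?E1" using acyclic_pendant[OF DN.prems(1)] disj by simp
  moreover have "set_dt l \<inter> insert v (\<Union>?E1) = {}" using disj by auto
  ultimately have E2: "acyclic_edges ?E2" by (intro DN.IH(1)[OF _ disj(4)])
  have "\<Union>(inner l) \<subseteq> set_dt l" by (intro Union_least inner_subset)
  then have "\<Union>?E2 \<subseteq> insert v (insert p (\<Union>E)) \<union> set_dt l"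
    using apex_in[of l] by (simp add: subset_iff)
  moreover have "R \<inter> insert v U = {}"
    if "U \<subseteq> insert v (insert p W) \<union> L" "v \<notin> R" "p \<notin> R" "R \<inter> W = {}" "L \<inter> R = {}" for L R U W
    using that by blast
  ultimately have "set_dt r \<inter> insert v (\<Union>?E2) = {}" using disj by metis
  from DN.IH(2)[OF E2 disj(5) this]
  have "acyclic_edges (insert {v, apex r} ?E2 \<union> inner r)" .
  moreover have "insert {v, apex r} ?E2 \<union> inner r = insert {p, apex (DN v l r)} E \<union> inner (DN v l r)"
    by (simp only: inner.simps apex.simps) blast
  ultimately show ?case by simp
qed

lemma connected_dt:
  "\<lbrakk>inner d \<subseteq> E; x \<in> set_dt d\<rbrakk> \<Longrightarrow> (apex d, x) \<in> {(x, y). {x, y} \<in> E}\<^sup>*"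
proof (induction d)
  case (DN v l r)
  have "{v, apex l} \<in> E" "{v, apex r} \<in> E" "inner l \<subseteq> E" "inner r \<subseteq> E" using DN.prems(1) by auto
  then have "(v, apex l) \<in> {(x, y). {x, y} \<in> E}" "(v, apex r) \<in> {(x, y). {x, y} \<in> E}" by simp_all
  moreover consider "x = v" | "x \<in> set_dt l" | "x \<in> set_dt r" using DN.prems(2) by auto
  ultimately show ?case
    using DN.IH \<open>inner l \<subseteq> E\<close> \<open>inner r \<subseteq> E\<close>
    by cases (auto intro: converse_rtrancl_into_rtrancl)
qed simp

lemma represents_valence:
  assumes "represents n T d"
  shows "x \<in> set_dt d \<Longrightarrow> valence T x = (if x \<in> fst ` tips d then 1 else 3)"
    and "valence T (root T) = 1"
proof -
  have r: "root T \<notin> set_dt d" "proper d" "edges T = {{root T, apex d}} \<union> inner d"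
    using assms by (simp_all add: represents_def)
  show "valence T x = (if x \<in> fst ` tips d then 1 else 3)" if "x \<in> set_dt d"
    unfolding valence_def r(3) using card_star[OF attached_root[OF r(1)] r(2) that] .
  have "root T \<notin> e" if "e \<in> inner d" for e using inner_subset[OF that] r(1) by blast
  then have "{e \<in> edges T. root T \<in> e} = {{root T, apex d}}" unfolding r(3) by blast
  then show "valence T (root T) = 1" by (simp add: valence_def)
qed

lemma represents_labeled_tree:
  assumes rep: "represents n T d"
  shows "labeled_tree n T"
proof -
  have r: "root T \<notin> set_dt d" "proper d" "verts T = insert (root T) (set_dt d)"
      "edges T = insert {root T, apex d} (inner d)" "\<And>v i. (v, i) \<in> tips d \<Longrightarrow> end_at T i = v"
      "set_tm (shape d) = {0..n}"
    using rep by (auto simp: represents_def)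
  note val = represents_valence[OF rep]
  have ne: "root T \<noteq> apex d" using r(1) by (metis apex_in)
  have "simple_graph T"
    unfolding simple_graph_def
  proof (intro conjI ballI)
    show "finite (verts T)" by (simp add: r(3))
    fix e assume "e \<in> edges T"
    then consider "e = {root T, apex d}" | "e \<in> inner d" using r(4) by blast
    then show "e \<subseteq> verts T" "card e = 2"
      using r(2,3) ne inner_subset[of e d] inner_card[of d e] by (cases; auto)+
  qed
  moreover have "connected_graph T"
  proof -
    let ?R = "{(x, y). {x, y} \<in> edges T}"
    have "sym ?R" by (auto simp: sym_def insert_commute)
    then have sym: "sym (?R\<^sup>*)" by (rule sym_rtrancl)
    have "(root T, apex d) \<in> ?R" by (simp add: r(4))
    moreover have "(apex d, x) \<in> ?R\<^sup>*" if "x \<in> set_dt d" for x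
      using connected_dt[of d "edges T" x] that r(4) by blast
    ultimately have root: "(root T, x) \<in> ?R\<^sup>*" if "x \<in> verts T" for x
      using that unfolding r(3) by (auto intro: converse_rtrancl_into_rtrancl)
    show ?thesis
      unfolding connected_graph_def
    proof (intro ballI)
      fix u v assume "u \<in> verts T" "v \<in> verts T"
      then show "(u, v) \<in> ?R\<^sup>*" using rtrancl_trans[OF symD[OF sym root] root] by blast
    qed
  qed
  moreover have "\<nexists>p. is_cycle T p"
  proof -
    have "acyclic_edges ({} :: nat set set)"
      unfolding acyclic_edges_def by (metis empty_iff gr_zeroI not_numeral_le_zero)
    then have "acyclic_edges (insert {root T, apex d} {} \<union> inner d)"
      by (rule acyclic_dt) (use r in auto)
    then show ?thesis by (simp add: acyclic_edges_def is_cycle_def r(4))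
  qed
  moreover have "\<forall>v\<in>verts T. valence T v \<in> {1, 3}" using val r(3) by auto
  ultimately have tree: "binary_tree T" by (simp add: binary_tree_def)
  have leaves: "leaves T = insert (root T) (fst ` tips d)"
  proof (rule set_eqI)
    fix x
    consider "x = root T" | "x \<noteq> root T" "x \<in> set_dt d" | "x \<notin> verts T" using r(3) by blast
    then show "x \<in> leaves T \<longleftrightarrow> x \<in> insert (root T) (fst ` tips d)"
    proof cases
      case 1
      then show ?thesis using val(2) r(3) by (simp add: leaves_def)
    next
      case 2
      then show ?thesis using val(1)[of x] r(3) by (simp add: leaves_def)
    next
      case 3
      then show ?thesis using tips_subset[of d] r(3) by (auto simp: leaves_def)
    qed
  qed
  have "root T \<notin> fst ` tips d" using r(1) tips_subset[of d] by auto
  then have diff: "leaves T - {root T} = fst ` tips d" using leaves by auto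
  have labels: "snd ` tips d = {0..n}" using snd_tips[of d] r(6) by simp
  have bij: "bij_betw (end_at T) {0..n} (leaves T - {root T})"
    unfolding bij_betw_def diff
  proof
    show "inj_on (end_at T) {0..n}"
    proof (rule inj_onI)
      fix i j assume "i \<in> {0..n}" "j \<in> {0..n}" "end_at T i = end_at T j"
      moreover from this obtain v w where "(v, i) \<in> tips d" "(w, j) \<in> tips d"
        unfolding labels[symmetric] by auto
      ultimately show "i = j" using r(5) tips_unique[OF r(2)] by metis
    qed
    show "end_at T ` {0..n} = fst ` tips d"
      unfolding labels[symmetric] image_image using r(5) by (intro image_cong) auto
  qed
  have "card (leaves T) = Suc (card (fst ` tips d))"
    unfolding leaves using \<open>root T \<notin> fst ` tips d\<close> tips_subset[of d] finite_subset by fastforce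
  moreover have "card (fst ` tips d) = n + 1" using bij_betw_same_card[OF bij] diff by simp
  ultimately show ?thesis unfolding labeled_tree_def using tree bij leaves by simp
qed

text \<open>The lift is applied with the root edge as the whole outside. The moved edges avoid the
  tips, so both their endpoints have valence three and the edges are interior.\<close>

lemma represents_step:
  assumes rep: "represents n T d" and par: "par (shape d) t"
  shows "\<exists>T' d'. represents n T' d' \<and> shape d' = t \<and> simultaneous_move T T'"
proof -
  have r: "root T \<notin> set_dt d" "proper d" "verts T = insert (root T) (set_dt d)"
      "edges T = {{root T, apex d}} \<union> inner d" "\<forall>(v, i)\<in>tips d. end_at T i = v"
      "set_tm (shape d) = {0..n}"
    using rep by (auto simp: represents_def)
  obtain d' where d': "shape d' = t" "liftable {} d d'" using par_liftable[OF par refl r(2)] by blast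
  then have sim: "similar d d'" and real: "realizable {} d d'" by (simp_all add: liftable_def)
  let ?T = "T\<lparr>edges := {{root T, apex d}} \<union> inner d'\<rparr>"
  obtain es where es: "whitehead_moves T es ?T" "sorted_wrt disjnt es"
    "\<forall>e\<in>set es. e \<in> inner d \<and> e \<inter> fst ` tips d = {} \<and> e \<inter> {} = {}"
    by (rule realizableD[OF real attached_root[OF r(1)] r(4)])
  have "e \<in> interior_edges T" if "e \<in> set es" for e
  proof -
    have e: "e \<in> inner d" "e \<inter> fst ` tips d = {}" using bspec[OF es(3) that] by blast+
    have "valence T x = 3" if "x \<in> e" for x
    proof -
      have "x \<in> set_dt d" "x \<notin> fst ` tips d" using inner_subset[OF e(1)] e(2) that by blast+
      then show ?thesis using represents_valence(1)[OF rep, of x] by simp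
    qed
    then show ?thesis using e(1) r(4) by (simp add: interior_edges_def)
  qed
  then have "simultaneous_move T ?T" unfolding simultaneous_move_def using es(1,2) by blast
  moreover have "represents n ?T d'"
    using r sim snd_tips[of d] snd_tips[of d'] by (simp add: represents_def similar_def)
  ultimately show ?thesis using d'(1) by blast
qed

section \<open>Terms of equal shape give isomorphic trees\<close>

lemma apex_map [simp]: "apex (map_dt f d) = f (apex d)"
  by (cases d) auto

lemma inner_map: "inner (map_dt f d) = (`) f ` inner d"
  by (induction d) (simp_all add: image_Un)

lemma tips_map: "(v, i) \<in> tips d \<Longrightarrow> (f v, i) \<in> tips (map_dt f d)"
  by (induction d) auto

lemma proper_map_inj: "proper (map_dt f d) \<Longrightarrow> inj_on f (set_dt d)"
proof (induction d)
  case (DN v l r)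
  then have "inj_on f (set_dt l)" "inj_on f (set_dt r)" "f ` set_dt l \<inter> f ` set_dt r = {}"
    "f v \<notin> f ` set_dt l" "f v \<notin> f ` set_dt r"
    by (simp_all add: dt.set_map)
  then have "inj_on f (set_dt l \<union> set_dt r)" "f v \<notin> f ` (set_dt l \<union> set_dt r)"
    unfolding inj_on_Un image_Un by blast+
  then show ?case by auto
qed simp

text \<open>The vertex maps of the two subtrees can be glued, because properness makes their domains
  and \<open>v\<close> disjoint.\<close>

lemma shape_eq_map:
  assumes "shape d = shape d'" "proper d"
  shows "\<exists>f. d' = map_dt f d"
  using assms
proof (induction d arbitrary: d')
  case (DL v i)
  then obtain w where "d' = DL w i" by (cases d') auto
  then show ?case by (intro exI[of _ "\<lambda>_. w"]) simp
next
  case (DN v l r)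
  then obtain w l' r' where d': "d' = DN w l' r'" "shape l = shape l'" "shape r = shape r'"
    by (cases d') auto
  have p: "proper l" "proper r" using DN.prems(2) by simp_all
  obtain f g where fg: "l' = map_dt f l" "r' = map_dt g r"
    using DN.IH(1)[OF d'(2) p(1)] DN.IH(2)[OF d'(3) p(2)] by blast
  define h where "h = (\<lambda>x. if x = v then w else if x \<in> set_dt l then f x else g x)"
  have "map_dt h l = map_dt f l"
    using DN.prems(2) by (intro dt.map_cong refl) (auto simp: h_def)
  moreover have "map_dt h r = map_dt g r"
    using DN.prems(2) by (intro dt.map_cong refl) (auto simp: h_def)
  ultimately have "d' = map_dt h (DN v l r)" using d'(1) fg by (simp add: h_def)
  then show ?case by blast
qed

lemma represents_iso:
  assumes d: "represents n T d" and d': "represents n T' d'" and eq: "shape d = shape d'"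
  shows "(T, T') \<in> tree_iso n"
proof -
  have r: "root T \<notin> set_dt d" "proper d" "verts T = insert (root T) (set_dt d)"
      "edges T = insert {root T, apex d} (inner d)" "\<And>v i. (v, i) \<in> tips d \<Longrightarrow> end_at T i = v"
      "set_tm (shape d) = {0..n}"
    using d by (auto simp: represents_def)
  have r': "root T' \<notin> set_dt d'" "proper d'" "verts T' = insert (root T') (set_dt d')"
      "edges T' = insert {root T', apex d'} (inner d')" "\<And>v i. (v, i) \<in> tips d' \<Longrightarrow> end_at T' i = v"
    using d' by (auto simp: represents_def)
  obtain g where g: "d' = map_dt g d" using shape_eq_map[OF eq r(2)] by blast
  \<comment> \<open>The root lies outside \<open>d\<close>, so redefining \<open>g\<close> there
    does not disturb the map on \<open>d\<close>.\<close>
  define f where "f = g(root T := root T')"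
  have f: "f (root T) = root T'" "\<And>x. x \<in> set_dt d \<Longrightarrow> f x = g x"
    using r(1) by (auto simp: f_def)
  have "d' = map_dt f d" unfolding g using f(2) by (intro dt.map_cong refl) auto
  note d'_eq = this
  have set': "set_dt d' = f ` set_dt d" unfolding d'_eq by (rule dt.set_map)
  have "inj_on f (set_dt d)" using proper_map_inj[of f d] r'(2) d'_eq by simp
  then have "inj_on f (verts T)" unfolding r(3) using r'(1) f(1) set' by (simp add: image_iff)
  moreover have "f ` verts T = verts T'" unfolding r(3) r'(3) set' using f(1) by simp
  ultimately have "bij_betw f (verts T) (verts T')" by (simp add: bij_betw_def)
  moreover have "(`) f ` edges T = edges T'"
    unfolding r(4) r'(4) d'_eq inner_map by (simp add: f(1))
  moreover have "f (end_at T i) = end_at T' i" if "i \<le> n" for i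
  proof -
    have "i \<in> snd ` tips d" using that r(6) snd_tips[of d] by simp
    then obtain v where v: "(v, i) \<in> tips d" by auto
    have "(f v, i) \<in> tips d'" unfolding d'_eq using v by (rule tips_map)
    then show ?thesis using r(5)[OF v] r'(5) by simp
  qed
  ultimately show ?thesis
    unfolding tree_iso_def using f(1) represents_labeled_tree[OF d] represents_labeled_tree[OF d']
    by blast
qed

lemma labeled_treeD:
  assumes "labeled_tree n T"
  shows "e \<in> edges T \<Longrightarrow> e \<subseteq> verts T" "root T \<in> verts T" "i \<le> n \<Longrightarrow> end_at T i \<in> verts T"
  using assms unfolding labeled_tree_def binary_tree_def simple_graph_def leaves_def bij_betw_def
  by auto

section \<open>Isomorphism as an equivalence relation\<close>

lemma equiv_tree_iso: "equiv {T. labeled_tree n T} (tree_iso n)"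
proof (rule equivI)
  show "tree_iso n \<subseteq> {T. labeled_tree n T} \<times> {T. labeled_tree n T}" by (auto simp: tree_iso_def)
  show "refl_on {T. labeled_tree n T} (tree_iso n)"
  proof (rule refl_onI)
    fix T assume "T \<in> {T. labeled_tree n T}"
    moreover have "bij_betw id (verts T) (verts T)" "(`) id ` edges T = edges T" by auto
    ultimately show "(T, T) \<in> tree_iso n" unfolding tree_iso_def by (auto intro!: exI[of _ id])
  qed
  show "sym (tree_iso n)"
  proof (rule symI)
    fix T T' assume "(T, T') \<in> tree_iso n"
    then obtain f where T: "labeled_tree n T" "labeled_tree n T'" and f: "bij_betw f (verts T) (verts T')"
      "(`) f ` edges T = edges T'" "f (root T) = root T'" "\<forall>i\<le>n. f (end_at T i) = end_at T' i"
      unfolding tree_iso_def by blast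
    let ?g = "inv_into (verts T) f"
    have inv: "?g (f x) = x" if "x \<in> verts T" for x
      using that f(1) by (simp add: bij_betw_def inv_into_f_f)
    have "?g ` f ` e = e" if "e \<in> edges T" for e
    proof -
      have "?g ` f ` e = id ` e" unfolding image_image
        using inv labeled_treeD(1)[OF T(1) that] by (intro image_cong) auto
      then show ?thesis by simp
    qed
    then have "(`) ?g ` edges T' = edges T" unfolding f(2)[symmetric] image_image by simp
    moreover have "bij_betw ?g (verts T') (verts T)" using f(1) by (rule bij_betw_inv_into)
    moreover have "?g (root T') = root T" using inv labeled_treeD(2)[OF T(1)] f(3) by metis
    moreover have "\<forall>i\<le>n. ?g (end_at T' i) = end_at T i" using inv labeled_treeD(3)[OF T(1)] f(4) by metis
    ultimately show "(T', T) \<in> tree_iso n" unfolding tree_iso_def using T by blast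
  qed
  show "trans (tree_iso n)"
  proof (rule transI)
    fix T T' T'' assume 1: "(T, T') \<in> tree_iso n" and 2: "(T', T'') \<in> tree_iso n"
    from 1 2 have T: "labeled_tree n T" "labeled_tree n T''" unfolding tree_iso_def by blast+
    from 1 obtain f where f: "bij_betw f (verts T) (verts T')"
        "(`) f ` edges T = edges T'" "f (root T) = root T'" "\<forall>i\<le>n. f (end_at T i) = end_at T' i"
      unfolding tree_iso_def by blast
    from 2 obtain g where g: "bij_betw g (verts T') (verts T'')"
        "(`) g ` edges T' = edges T''" "g (root T') = root T''" "\<forall>i\<le>n. g (end_at T' i) = end_at T'' i"
      unfolding tree_iso_def by blast
    have "bij_betw (g \<circ> f) (verts T) (verts T'')" using f(1) g(1) by (rule bij_betw_trans)
    moreover have "(`) (g \<circ> f) ` edges T = edges T''"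
      unfolding g(2)[symmetric] f(2)[symmetric] image_image by (simp add: image_comp)
    moreover have "(g \<circ> f) (root T) = root T''" "\<forall>i\<le>n. (g \<circ> f) (end_at T i) = end_at T'' i"
      using f g by simp_all
    ultimately show "(T, T'') \<in> tree_iso n" unfolding tree_iso_def using T by blast
  qed
qed

lemma valence_neighbors:
  assumes "simple_graph T"
  shows "valence T v = card (neighbors T v)"
proof -
  have "{e \<in> edges T. v \<in> e} = (\<lambda>w. {v, w}) ` neighbors T v"
  proof (intro equalityI subsetI)
    fix e assume e: "e \<in> {e \<in> edges T. v \<in> e}"
    then have "card e = 2" using assms by (auto simp: simple_graph_def)
    then obtain x y where "e = {x, y}" by (auto simp: card_2_iff)
    then have "e = {v, x} \<or> e = {v, y}" using e by auto
    then show "e \<in> (\<lambda>w. {v, w}) ` neighbors T v" using e by (auto simp: neighbors_def)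
  qed (auto simp: neighbors_def)
  moreover have "inj_on (\<lambda>w. {v, w}) (neighbors T v)" by (auto simp: inj_on_def doubleton_eq_iff)
  ultimately show ?thesis unfolding valence_def by (simp add: card_image)
qed

section \<open>Every labeled tree is represented by a term\<close>

text \<open>\<open>S\<close> is closed along inner edges, so membership climbs from \<open>x\<close>
  to the apex. This serves to show that two branches at a vertex are disjoint.\<close>

lemma invariant_dt:
  "\<lbrakk>\<And>e. e \<in> inner d \<Longrightarrow> e \<inter> S \<noteq> {} \<Longrightarrow> e \<subseteq> S; x \<in> set_dt d; x \<in> S\<rbrakk> \<Longrightarrow> apex d \<in> S"
proof (induction d)
  case (DN v l r)
  have *: "e \<in> inner l \<or> e \<in> inner r \<Longrightarrow> e \<inter> S \<noteq> {} \<Longrightarrow> e \<subseteq> S" for e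
    using DN.prems(1)[of e] by (simp only: inner.simps Un_iff) blast
  have **: "apex l \<in> S \<Longrightarrow> v \<in> S" "apex r \<in> S \<Longrightarrow> v \<in> S"
    using DN.prems(1)[of "{v, apex l}"] DN.prems(1)[of "{v, apex r}"] by auto
  consider "x = v" | "x \<in> set_dt l" | "x \<in> set_dt r" using DN.prems(2) by auto
  then show ?case
  proof cases
    case 1
    then show ?thesis using DN.prems(3) by simp
  next
    case 2
    then have "apex l \<in> S" using DN.IH(1) * DN.prems(3) by blast
    then show ?thesis using ** by simp
  next
    case 3
    then have "apex r \<in> S" using DN.IH(2) * DN.prems(3) by blast
    then show ?thesis using ** by simp
  qed
qed simp

text \<open>
  \<open>d\<close> is the part of \<open>T\<close> behind its apex, as seen from the neighbor \<open>p\<close> of the apex, and \<open>Q\<close> is the set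
  of vertices on the path already traversed.
\<close>

definition branch :: "ltree \<Rightarrow> (nat \<Rightarrow> nat) \<Rightarrow> nat \<Rightarrow> nat set \<Rightarrow> nat dt \<Rightarrow> bool" where
  "branch T lab p Q d \<longleftrightarrow> proper d \<and> set_dt d \<subseteq> verts T \<and> set_dt d \<inter> Q = {} \<and> inner d \<subseteq> edges T \<and>
     (\<forall>e\<in>edges T. e \<inter> set_dt d \<noteq> {} \<longrightarrow> e = {p, apex d} \<or> e \<in> inner d) \<and> (\<forall>(v, i)\<in>tips d. i = lab v)"

lemma branch_node:
  assumes a: "branch T lab v (insert v Q) da" and b: "branch T lab v (insert v Q) db"
    and ab: "apex da \<noteq> apex db" and nb: "neighbors T v = {p, apex da, apex db}"
    and v: "v \<in> verts T" "v \<notin> Q" and T: "simple_graph T"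
  shows "branch T lab p Q (DN v da db)"
proof -
  have a': "proper da" "set_dt da \<subseteq> verts T" "set_dt da \<inter> Q = {}" "v \<notin> set_dt da" "inner da \<subseteq> edges T"
      "\<And>e. e \<in> edges T \<Longrightarrow> e \<inter> set_dt da \<noteq> {} \<Longrightarrow> e = {v, apex da} \<or> e \<in> inner da"
      "\<forall>(v, i)\<in>tips da. i = lab v"
    using a unfolding branch_def by blast+
  have b': "proper db" "set_dt db \<subseteq> verts T" "set_dt db \<inter> Q = {}" "v \<notin> set_dt db" "inner db \<subseteq> edges T"
      "\<And>e. e \<in> edges T \<Longrightarrow> e \<inter> set_dt db \<noteq> {} \<Longrightarrow> e = {v, apex db} \<or> e \<in> inner db"
      "\<forall>(v, i)\<in>tips db. i = lab v"
    using b unfolding branch_def by blast+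
  have ea: "{v, apex da} \<in> edges T" and eb: "{v, apex db} \<in> edges T"
    using nb by (auto simp: neighbors_def)
  \<comment> \<open>If the branches met, closure along the inner edges of \<open>db\<close> would
    put its apex into \<open>da\<close>. The edge from \<open>v\<close> to that apex would then be
    an inner edge of \<open>da\<close>, although \<open>v\<close> is not in
    \<open>da\<close>.\<close>
  have disj: "set_dt da \<inter> set_dt db = {}"
  proof (rule ccontr)
    assume "set_dt da \<inter> set_dt db \<noteq> {}"
    then obtain x where x: "x \<in> set_dt db" "x \<in> set_dt da" by blast
    have "e \<subseteq> set_dt da" if e: "e \<in> inner db" "e \<inter> set_dt da \<noteq> {}" for e
    proof -
      have "v \<notin> e" using inner_subset[OF e(1)] b'(4) by blast
      then have "e \<noteq> {v, apex da}" by blast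
      moreover have "e \<in> edges T" using e(1) b'(5) by blast
      ultimately have "e \<in> inner da" using a'(6)[OF _ e(2)] by blast
      then show ?thesis by (rule inner_subset)
    qed
    then have "apex db \<in> set_dt da" using invariant_dt[of db "set_dt da" x] x by blast
    then have "{v, apex db} \<inter> set_dt da \<noteq> {}" by blast
    from a'(6)[OF eb this] have "{v, apex db} \<in> inner da" using ab by (auto simp: doubleton_eq_iff)
    then show False using inner_subset a'(4) by blast
  qed
  have star: "e \<in> {{v, p}, {v, apex da}, {v, apex db}}" if e: "e \<in> edges T" "v \<in> e" for e
  proof -
    have "card e = 2" using T e(1) by (auto simp: simple_graph_def)
    then obtain x y where xy: "e = {x, y}" by (auto simp: card_2_iff)
    then obtain w where "e = {v, w}" using e(2) by blast
    moreover from this have "w \<in> neighbors T v" using e(1) by (simp add: neighbors_def)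
    ultimately show ?thesis unfolding nb by blast
  qed
  have "e = {p, v} \<or> e \<in> inner (DN v da db)" if e: "e \<in> edges T" "e \<inter> set_dt (DN v da db) \<noteq> {}" for e
  proof -
    consider "v \<in> e" | "e \<inter> set_dt da \<noteq> {}" | "e \<inter> set_dt db \<noteq> {}" using e(2) by auto
    then show ?thesis
    proof cases
      case 1
      from star[OF e(1) this] show ?thesis by (auto simp: insert_commute)
    next
      case 2
      from a'(6)[OF e(1) this] show ?thesis by auto
    next
      case 3
      from b'(6)[OF e(1) this] show ?thesis by auto
    qed
  qed
  moreover have "proper (DN v da db)" using a' b' disj by simp
  moreover have "set_dt (DN v da db) \<subseteq> verts T" "set_dt (DN v da db) \<inter> Q = {}"
    using a'(2,3) b'(2,3) v by auto
  moreover have "inner (DN v da db) \<subseteq> edges T" using a'(5) b'(5) ea eb by simp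
  moreover have "\<forall>(v, i)\<in>tips (DN v da db). i = lab v" using a'(7) b'(7) by auto
  ultimately show ?thesis by (simp add: branch_def del: inner.simps)
qed

text \<open>The tree is explored away from the root; \<open>v # p # q\<close> is the path walked so
  far, listed backwards. A further neighbor of \<open>v\<close> cannot lie on the path by
  acyclicity, and the path cannot outgrow the finite vertex set.\<close>

lemma branch_exists:
  assumes T: "binary_tree T"
  shows "\<lbrakk>card (verts T) - length q = k; distinct (v # p # q); set (v # p # q) \<subseteq> verts T;
      \<forall>i. Suc i < length (v # p # q) \<longrightarrow> {(v # p # q) ! i, (v # p # q) ! Suc i} \<in> edges T\<rbrakk>
    \<Longrightarrow> \<exists>d. apex d = v \<and> branch T lab p (set (p # q)) d"
proof (induction k arbitrary: v p q rule: less_induct)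
  case (less k)
  have simple: "simple_graph T" and cyc: "\<nexists>q. is_cycle T q"
    and val: "\<And>v. v \<in> verts T \<Longrightarrow> valence T v \<in> {1, 3}"
    using T by (auto simp: binary_tree_def)
  have v: "v \<in> verts T" "v \<notin> set (p # q)" using less.prems by auto
  have ep: "{v, p} \<in> edges T" using less.prems(4)[rule_format, of 0] by simp
  then have p: "p \<in> neighbors T v" by (simp add: neighbors_def)
  have "card (neighbors T v) \<in> {1, 3}" using val[OF v(1)] valence_neighbors[OF simple] by simp
  then consider "card (neighbors T v) = 1" | "card (neighbors T v) = 3" by blast
  then show ?case
  proof cases
    case 1
    then have nb: "neighbors T v = {p}" using p by (auto simp: card_1_singleton_iff)
    have "e = {p, v}" if e: "e \<in> edges T" "v \<in> e" for e
    proof -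
      have "card e = 2" using simple e(1) by (auto simp: simple_graph_def)
      then obtain x y where xy: "e = {x, y}" by (auto simp: card_2_iff)
      then obtain w where "e = {v, w}" using e(2) by blast
      moreover from this have "w \<in> neighbors T v" using e(1) by (simp add: neighbors_def)
      ultimately show ?thesis unfolding nb by blast
    qed
    then have "branch T lab p (set (p # q)) (DL v (lab v))"
      using v by (simp add: branch_def)
    then show ?thesis by (intro exI[of _ "DL v (lab v)"]) simp
  next
    case 2
    then have "finite (neighbors T v)" by (metis card.infinite zero_neq_numeral)
    then have "card (neighbors T v - {p}) = 2" using 2 p by simp
    then obtain a b where ab: "neighbors T v - {p} = {a, b}" "a \<noteq> b" by (auto simp: card_2_iff)
    then have nb: "neighbors T v = {p, a, b}" using p by blast
    have sub: "\<exists>d. apex d = c \<and> branch T lab v (set (v # p # q)) d" if c: "c \<in> {a, b}" for c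
    proof -
      have ec: "{v, c} \<in> edges T" and cp: "c \<noteq> p" using c ab by (auto simp: neighbors_def)
      have "card {v, c} = 2" "c \<in> verts T" using simple ec by (auto simp: simple_graph_def)
      then have cv: "c \<noteq> v" by auto
      have cq: "c \<notin> set q"
      proof
        assume "c \<in> set q"
        then obtain i where i: "i < length q" "q ! i = c" by (auto simp: in_set_conv_nth)
        \<comment> \<open>The path from \<open>v\<close> back to \<open>c\<close>, closed by the
          edge \<open>{v, c}\<close>; its length \<open>i + 3\<close> is large enough for a
          cycle.\<close>
        let ?c = "v # p # take (Suc i) q"
        have len: "length ?c = i + 3" using i(1) by simp
        have "{?c ! j, ?c ! (Suc j mod length ?c)} \<in> edges T" if j: "j < length ?c" for j
        proof (cases "Suc j < length ?c")
          case True
          have tk: "?c = take (i + 3) (v # p # q)" by (simp add: numeral_3_eq_3)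
          have "?c ! j = (v # p # q) ! j" "?c ! Suc j = (v # p # q) ! Suc j"
            unfolding tk using True len by (auto intro!: nth_take simp del: take_Suc_Cons)
          moreover have "Suc j < length (v # p # q)" using True len i(1) by simp
          ultimately show ?thesis using True less.prems(4) by simp
        next
          case False
          then have "j = i + 2" using j len by simp
          moreover have "?c ! (i + 2) = c" using i by (simp add: nth_append)
          ultimately show ?thesis using len ec by (simp add: insert_commute)
        qed
        moreover have "distinct ?c" using less.prems(2) by (auto dest: in_set_takeD)
        ultimately have "is_cycle T ?c" using len unfolding is_cycle_def by simp
        then show False using cyc by blast
      qed
      \<comment> \<open>This makes the truncated difference positive, so lengthening the path
        strictly decreases it.\<close>
      have "length (v # p # q) \<le> card (verts T)"
        using less.prems(2,3) simple by (metis card_mono distinct_card simple_graph_def)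
      then have "card (verts T) - length (p # q) < k" using less.prems(1) by simp
      moreover have "distinct (c # v # p # q)" using less.prems(2) cv cp cq by simp
      moreover have "set (c # v # p # q) \<subseteq> verts T" using less.prems(3) \<open>c \<in> verts T\<close> by simp
      moreover have "\<forall>i. Suc i < length (c # v # p # q) \<longrightarrow>
          {(c # v # p # q) ! i, (c # v # p # q) ! Suc i} \<in> edges T"
      proof (intro allI impI)
        fix i assume i: "Suc i < length (c # v # p # q)"
        show "{(c # v # p # q) ! i, (c # v # p # q) ! Suc i} \<in> edges T"
        proof (cases i)
          case 0
          then show ?thesis using ec by (simp add: insert_commute)
        next
          case (Suc j)
          then show ?thesis using less.prems(4)[rule_format, of j] i by simp
        qed
      qed
      ultimately show ?thesis using less.IH[OF _ refl, of "p # q" c v] by blast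
    qed
    obtain da db where d: "apex da = a" "branch T lab v (set (v # p # q)) da"
        "apex db = b" "branch T lab v (set (v # p # q)) db"
      using sub[of a] sub[of b] by blast
    have "branch T lab p (set (p # q)) (DN v da db)"
      using branch_node[of T lab v "set (p # q)" da db p] d ab(2) nb v simple by simp
    then show ?thesis by (intro exI[of _ "DN v da db"]) simp
  qed
qed

text \<open>The branch behind the only neighbor of the root, together with the root, is closed under
  adjacency; by connectedness it is the whole tree.\<close>

lemma represents_exists:
  assumes T: "labeled_tree n T"
  shows "\<exists>d. represents n T d"
proof -
  let ?r = "root T" and ?lab = "inv_into {0..n} (end_at T)"
  have tree: "binary_tree T" and rl: "?r \<in> leaves T"
    and bij: "bij_betw (end_at T) {0..n} (leaves T - {?r})"
    using T by (auto simp: labeled_tree_def)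
  have simple: "simple_graph T" and conn: "connected_graph T" using tree by (auto simp: binary_tree_def)
  have "card (neighbors T ?r) = 1" and rv: "?r \<in> verts T"
    using rl valence_neighbors[OF simple, of ?r] by (auto simp: leaves_def)
  then obtain v where nb: "neighbors T ?r = {v}" by (auto simp: card_1_singleton_iff)
  then have e: "{?r, v} \<in> edges T" by (auto simp: neighbors_def)
  then have "v \<in> verts T" "card {?r, v} = 2" using simple by (auto simp: simple_graph_def)
  then have "v \<noteq> ?r" by auto
  have path: "{[v, ?r] ! i, [v, ?r] ! Suc i} \<in> edges T" if "Suc i < length [v, ?r]" for i
    using that e by (auto simp: insert_commute)
  obtain d where d: "apex d = v" "branch T ?lab ?r (set [?r]) d"
    using branch_exists[OF tree refl, of v ?r "[]" ?lab] path \<open>v \<noteq> ?r\<close> \<open>v \<in> verts T\<close> rv by auto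
  have b: "proper d" "set_dt d \<subseteq> verts T" "?r \<notin> set_dt d" "inner d \<subseteq> edges T"
      "\<And>e. e \<in> edges T \<Longrightarrow> e \<inter> set_dt d \<noteq> {} \<Longrightarrow> e = {?r, v} \<or> e \<in> inner d"
      "\<forall>(v, i)\<in>tips d. i = ?lab v"
    using d unfolding branch_def by auto
  have star: "e = {?r, v}" if e: "e \<in> edges T" "?r \<in> e" for e
  proof -
    have "card e = 2" using simple e(1) by (auto simp: simple_graph_def)
    then obtain x y where xy: "e = {x, y}" by (auto simp: card_2_iff)
    then obtain w where "e = {?r, w}" using e(2) by blast
    moreover from this have "w \<in> neighbors T ?r" using e(1) by (simp add: neighbors_def)
    ultimately show ?thesis unfolding nb by blast
  qed
  let ?S = "insert ?r (set_dt d)"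
  have edge: "x \<in> ?S \<Longrightarrow> {x, y} \<in> edges T \<Longrightarrow> y \<in> ?S" for x y
  proof -
    assume x: "x \<in> ?S" and xy: "{x, y} \<in> edges T"
    have "{x, y} = {?r, v} \<or> {x, y} \<in> inner d"
      using x star[OF xy] b(5)[OF xy] by blast
    moreover have "v \<in> set_dt d" using d(1) apex_in by metis
    ultimately show "y \<in> ?S" using inner_subset[of "{x, y}" d] by blast
  qed
  have reach: "y \<in> ?S" if "(?r, y) \<in> {(x, y). {x, y} \<in> edges T}\<^sup>*" for y
    using that by (induction rule: rtrancl_induct) (use edge in auto)
  have verts: "verts T = ?S"
    using reach conn rv b(2) unfolding connected_graph_def by blast
  have "e = {?r, v} \<or> e \<in> inner d" if e: "e \<in> edges T" for e
  proof -
    have "e \<subseteq> ?S" "e \<noteq> {}" using e simple verts by (auto simp: simple_graph_def)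
    then have "?r \<in> e \<or> e \<inter> set_dt d \<noteq> {}" by blast
    then show ?thesis using star[OF e] b(5)[OF e] by blast
  qed
  then have edges: "edges T = insert {?r, apex d} (inner d)" unfolding d(1) using e b(4) by blast
  have "x \<in> leaves T - {?r} \<longleftrightarrow> x \<in> fst ` tips d" for x
  proof (cases "x \<in> set_dt d")
    case True
    then have "valence T x = (if x \<in> fst ` tips d then 1 else 3)"
      using card_star[OF attached_root[OF b(3)] b(1) True] by (simp add: valence_def edges)
    then show ?thesis using True verts b(3) by (auto simp: leaves_def split: if_splits)
  next
    case False
    then show ?thesis using verts tips_subset[of d] by (auto simp: leaves_def)
  qed
  then have leaves: "leaves T - {?r} = fst ` tips d" by blast
  have "snd ` tips d = ?lab ` fst ` tips d"
    unfolding image_image using b(6) by (intro image_cong) auto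
  also have "\<dots> = {0..n}" unfolding leaves[symmetric]
    using bij_betw_inv_into[OF bij] by (rule bij_betw_imp_surj_on)
  finally have labels: "set_tm (shape d) = {0..n}" by (simp only: snd_tips)
  have "end_at T i = x" if "(x, i) \<in> tips d" for x i
  proof -
    have "x \<in> end_at T ` {0..n}" using that leaves bij by (force simp: bij_betw_def)
    moreover have "i = ?lab x" using b(6) that by auto
    ultimately show ?thesis by (simp add: f_inv_into_f)
  qed
  then have "represents n T d" using b verts edges labels by (auto simp: represents_def)
  then show ?thesis by (rule exI)
qed

section \<open>The diameter\<close>

lemma represents_steps:
  "\<lbrakk>represents n T d; (par ^^ k) (shape d) t\<rbrakk> \<Longrightarrow>
    \<exists>T' d'. represents n T' d' \<and> shape d' = t \<and>
      (tree_iso n `` {T}, tree_iso n `` {T'}) \<in> simultaneous_step n ^^ k"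
proof (induction k arbitrary: t)
  case 0
  then show ?case by (intro exI[of _ T] exI[of _ d]) simp
next
  case (Suc k)
  obtain u where u: "(par ^^ k) (shape d) u" "par u t" using Suc.prems(2) by (rule relpowp_Suc_E)
  obtain S e where S: "represents n S e" "shape e = u"
      "(tree_iso n `` {T}, tree_iso n `` {S}) \<in> simultaneous_step n ^^ k"
    using Suc.IH[OF Suc.prems(1) u(1)] by blast
  have "par (shape e) t" using S(2) u(2) by simp
  then obtain T' d' where T': "represents n T' d'" "shape d' = t" "simultaneous_move S T'"
    using represents_step[OF S(1)] by blast
  have lab: "labeled_tree n S" "labeled_tree n T'" using S(1) T'(1) represents_labeled_tree by blast+
  then have "tree_iso n `` {S} \<in> Tree n" "tree_iso n `` {T'} \<in> Tree n"
    unfolding Tree_def by (simp_all add: quotientI)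
  moreover have "S \<in> tree_iso n `` {S}" "T' \<in> tree_iso n `` {T'}"
    using equiv_class_self[OF equiv_tree_iso] lab by simp_all
  ultimately have "(tree_iso n `` {S}, tree_iso n `` {T'}) \<in> simultaneous_step n"
    unfolding simultaneous_step_def using T'(3) by blast
  then have "(tree_iso n `` {T}, tree_iso n `` {T'}) \<in> simultaneous_step n ^^ Suc k"
    using relpow_Suc_I[OF S(3)] by blast
  then show ?case using T'(1,2) by blast
qed

lemma represents_class:
  assumes "X \<in> Tree n"
  obtains T d where "X = tree_iso n `` {T}" "represents n T d"
proof -
  obtain T where "X = tree_iso n `` {T}" "labeled_tree n T"
    using assms unfolding Tree_def by (auto elim: quotientE)
  then show thesis using that represents_exists by blast
qed

lemma class_eqI:
  assumes "represents n T d" "represents n T' d'" "shape d = shape d'"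
  shows "tree_iso n `` {T} = tree_iso n `` {T'}"
  using equiv_class_eq[OF equiv_tree_iso represents_iso[OF assms]] .

lemma d_S_le:
  assumes "(X, Y) \<in> simultaneous_step n ^^ k"
  shows "d_S n X Y \<le> enat k"
  unfolding d_S_def using assms by (intro INF_lower) simp

lemma represents_distinct: "represents n T d \<Longrightarrow> distinct (leaf_list (shape d))"
  using distinct_labels[of d "end_at T"] by (simp add: represents_def)

text \<open>The labels up to \<open>n\<close> fit into \<open>m\<close> bits. The walk from
  \<open>d\<close> ends at a tree with the shape of \<open>e\<close>, which is isomorphic to
  \<open>S\<close> and so lies in the class \<open>Y\<close>.\<close>

lemma d_S_bound:
  assumes "n < 2 ^ m" "X \<in> Tree n" "Y \<in> Tree n"
  shows "d_S n X Y \<le> enat (118 * m)"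
proof -
  obtain T d where T: "X = tree_iso n `` {T}" "represents n T d" by (rule represents_class[OF assms(2)])
  obtain S e where S: "Y = tree_iso n `` {S}" "represents n S e" by (rule represents_class[OF assms(3)])
  have set: "set_tm (shape d) = {0..n}" "set_tm (shape e) = {0..n}"
    using T(2) S(2) by (simp_all add: represents_def)
  have "mset (leaf_list (shape d)) = mset (leaf_list (shape e))"
    using set_eq_iff_mset_eq_distinct[OF represents_distinct[OF T(2)] represents_distinct[OF S(2)]]
    by (simp add: set)
  moreover have "set_tm (shape d) \<subseteq> {..<2 ^ m}" using assms(1) set by auto
  ultimately have "(par ^^ (118 * m)) (shape d) (shape e)"
    using steps_between[OF represents_distinct[OF T(2)]] by blast
  from represents_steps[OF T(2) this] obtain T' d' where T': "represents n T' d'" "shape d' = shape e"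
      "(tree_iso n `` {T}, tree_iso n `` {T'}) \<in> simultaneous_step n ^^ (118 * m)"
    by blast
  then have "(X, Y) \<in> simultaneous_step n ^^ (118 * m)"
    using class_eqI[OF T'(1) S(2) T'(2)] T(1) S(1) by simp
  then show ?thesis by (rule d_S_le)
qed

section \<open>The smallest case and the logarithmic bound\<close>

lemma represents_swap:
  assumes "represents n T (DN v l r)"
  shows "represents n T (DN v r l)"
proof -
  have eqs: "set_dt (DN v r l) = set_dt (DN v l r)" "inner (DN v r l) = inner (DN v l r)"
    "tips (DN v r l) = tips (DN v l r)" "apex (DN v r l) = apex (DN v l r)"
    "proper (DN v r l) = proper (DN v l r)"
    "set_tm (shape (DN v r l)) = set_tm (shape (DN v l r))" by auto
  show ?thesis using assms unfolding represents_def eqs .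
qed

text \<open>For \<open>n = 1\<close> the logarithm vanishes, so the diameter must be exactly 0;
  indeed a term with two leaves is determined up to a swap.\<close>

lemma tree_one_shape:
  assumes "represents 1 T d"
  shows "\<exists>d'. represents 1 T d' \<and> shape d' = Nd (Lf 0) (Lf 1)"
proof -
  have set: "set_tm (shape d) = {0, 1}" and dist: "distinct (leaf_list (shape d))"
    using assms represents_distinct[OF assms] by (auto simp: represents_def)
  have len: "length (leaf_list (shape d)) = 2" using distinct_card[OF dist] set by simp
  then obtain v l r where d: "d = DN v l r" by (cases d) auto
  have "length (leaf_list (shape l)) + length (leaf_list (shape r)) = 2" using len d by simp
  then have "length (leaf_list (shape l)) = 1" "length (leaf_list (shape r)) = 1"
    using length_leaf_list_pos[of "shape l"] length_leaf_list_pos[of "shape r"] by linarith+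
  then obtain i j where ij: "shape l = Lf i" "shape r = Lf j"
    by (elim length_leaf_list_1D)
  then have "i = 0 \<and> j = 1 \<or> i = 1 \<and> j = 0" using set dist d by (auto simp: doubleton_eq_iff)
  then show ?thesis
  proof
    assume "i = 0 \<and> j = 1"
    then show ?thesis using assms d ij by (intro exI[of _ d]) simp
  next
    assume "i = 1 \<and> j = 0"
    then show ?thesis using represents_swap assms d ij by (intro exI[of _ "DN v r l"]) simp
  qed
qed

lemma d_S_one:
  assumes "X \<in> Tree 1" "Y \<in> Tree 1"
  shows "d_S 1 X Y \<le> 0"
proof -
  obtain T d where T: "X = tree_iso 1 `` {T}" "represents 1 T d" by (rule represents_class[OF assms(1)])
  obtain S e where S: "Y = tree_iso 1 `` {S}" "represents 1 S e" by (rule represents_class[OF assms(2)])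
  obtain d' where d': "represents 1 T d'" "shape d' = Nd (Lf 0) (Lf 1)"
    using tree_one_shape[OF T(2)] by (elim exE conjE)
  obtain e' where e': "represents 1 S e'" "shape e' = Nd (Lf 0) (Lf 1)"
    using tree_one_shape[OF S(2)] by (elim exE conjE)
  have "shape d' = shape e'" unfolding d'(2) e'(2) ..
  from class_eqI[OF d'(1) e'(1) this] have "X = Y" unfolding T(1) S(1) .
  then have "(X, Y) \<in> simultaneous_step 1 ^^ 0" by simp
  from d_S_le[OF this] show ?thesis by (simp add: zero_enat_def)
qed

theorem theorem3p1:
  "\<exists>K::real. \<forall>n::nat. 1 \<le> n \<longrightarrow> ereal_of_enat (diam_S n) \<le> ereal (K * ln (real n))"
proof (intro exI allI impI)
  fix n :: nat assume n: "1 \<le> n"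
  \<comment> \<open>With \<open>2 ^ k \<le> n < 2 ^ (k + 1)\<close>, the bound is
    \<open>118 * (k + 1)\<close>. For \<open>k \<ge> 1\<close> this is at most
    \<open>236 * k\<close>, and \<open>k \<le> ln n / ln 2\<close>.\<close>
  show "ereal_of_enat (diam_S n) \<le> ereal (236 / ln 2 * ln (real n))"
  proof (cases "n = 1")
    case True
    have "diam_S 1 \<le> 0" unfolding diam_S_def by (intro SUP_least d_S_one)
    then have "diam_S n = 0" unfolding True by (rule antisym) simp
    then show ?thesis using True by simp
  next
    case False
    obtain k where k: "2 ^ k \<le> n" "n < 2 ^ (k + 1)" using ex_power_ivl1[of 2 n] n by auto
    have "k \<noteq> 0" using k(2) n False by (cases k) auto
    have "diam_S n \<le> enat (118 * (k + 1))"
      unfolding diam_S_def by (intro SUP_least d_S_bound k(2))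
    then have "ereal_of_enat (diam_S n) \<le> ereal_of_enat (enat (118 * (k + 1)))"
      by (simp only: ereal_of_enat_le_iff)
    also have "\<dots> = ereal (118 * (real k + 1))" by simp
    also have "\<dots> \<le> ereal (236 / ln 2 * ln (real n))"
    proof -
      have "real (2 ^ k) \<le> real n" using k(1) by (simp only: of_nat_le_iff)
      then have "ln (2 ^ k) \<le> ln (real n)" by (subst ln_le_cancel_iff) (use n in auto)
      then have "real k * ln 2 \<le> ln (real n)" by (simp add: ln_realpow)
      then have "real k \<le> ln (real n) / ln 2" by (simp add: field_simps)
      moreover have "1 \<le> real k" using \<open>k \<noteq> 0\<close> by simp
      ultimately have "118 * real k + 118 * 1 \<le> 236 * (ln (real n) / ln 2)" by linarith
      then show ?thesis by (simp add: distrib_left)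
    qed
    finally show ?thesis .
  qed
qed

end
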